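(* Let $(S,d_S)$ be a Polish metric space and let $(X_{t,T}:t\in\mathbb Z,T\in\mathbb N)$ be an $S$-valued locally stationary process with auxiliary process $(X_t(u):t\in\mathbb Z,u\in[0,1])$, where for each fixed $u$ the stationary process $(X_t(u))_{t\in\mathbb Z}$ is ergodic. For $u\in[0,1]$ and $A\in\mathcal B(S)$ let $$\mu_{T,u}(\omega,A)=\frac1T\sum_{t=1}^{\lfloor uT\rfloor}\delta_{X_{t,T}(\omega)}(A),\qquad \tilde\mu_u(A)=\int_0^u\mathbb P(X_0(\eta)\in A)\,d\eta .$$ Then, as $T\to\infty$, $$\sup_{u\in[0,1]}d_{BL}(\mu_{T,u},\tilde\mu_u)\to0\quad\text{in probability}.$$
   Context: Local stationarity: $(X_{t,T})$ is a triangular array (sample $t=1,\dots,T$, extended by $X_{t,T}=X_{1,T}$ for $t\le0$ and $X_{t,T}=X_{T,T}$ for $t\ge T$) of $S$-valued random variables on a common probability space, and it is locally stationary if there is an $S$-valued process $(X_t(u):t\in\mathbb Z,u\in[0,1])$ (the auxiliary process), stationary in $t$ for each fixed $u$, such that $\mathbb E[d_S(X_{t,T},X_t(t/T))\wedge1]=O(T^{-1})$ and $\mathbb E[d_S(X_t(u),X_t(v))\wedge1]=O(|u-v|)$, uniformly in $t=1,\dots,T$ and $u,v\in[0,1]$. For nonnegative Borel measures $\mu,\nu$ on $S$ with total mass at most $1$, $d_{BL}(\mu,\nu)=\sup\{|\int f\,d\mu-\int f\,d\nu|:\|f\|_{BL}\le1\}$, where $\|f\|_{BL}=\|f\|_\infty+\mathrm{Lip}(f)$.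 *)

theory Defs
  imports "HOL-Probability.Probability"
begin

text \<open>
  The Polish metric space is a type of class \<open>polish_space\<close> (complete separable metric) with
  \<open>dist\<close> as its metric.
\<close>

subsection \<open>Stationary and ergodic processes indexed by the integers\<close>

definition process_law :: "'w measure \<Rightarrow> (int \<Rightarrow> 'w \<Rightarrow> 'a::topological_space) \<Rightarrow> (int \<Rightarrow> 'a) measure" where
  "process_law M Z = distr M (PiM UNIV (\<lambda>_. borel)) (\<lambda>\<omega> t. Z t \<omega>)"

definition stationary_process :: "'w measure \<Rightarrow> (int \<Rightarrow> 'w \<Rightarrow> 'a::topological_space) \<Rightarrow> bool" where
  "stationary_process M Z \<longleftrightarrow>
     (\<forall>t. Z t \<in> borel_measurable M) \<and>
     (\<forall>h. process_law M (\<lambda>t. Z (t + h)) = process_law M Z)"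

definition shift :: "(int \<Rightarrow> 'a) \<Rightarrow> int \<Rightarrow> 'a" where
  "shift x = (\<lambda>t. x (t + 1))"

definition ergodic_process :: "'w measure \<Rightarrow> (int \<Rightarrow> 'w \<Rightarrow> 'a::topological_space) \<Rightarrow> bool" where
  "ergodic_process M Z \<longleftrightarrow>
     (\<forall>B \<in> sets (process_law M Z). shift -` B = B \<longrightarrow>
        measure (process_law M Z) B = 0 \<or> measure (process_law M Z) B = 1)"

subsection \<open>Local stationarity\<close>

text \<open>
  Only sample sizes \<open>T \<ge> 1\<close> and parameters \<open>u \<in> {0..1}\<close> are constrained. In the last condition
  ``uniformly in \<open>t = 1, \<dots>, T\<close>'', with \<open>T\<close> arbitrary, amounts to all \<open>t \<ge> 1\<close>.
\<close>

definition locally_stationary ::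
  "'w measure \<Rightarrow> (int \<Rightarrow> nat \<Rightarrow> 'w \<Rightarrow> 'a::metric_space) \<Rightarrow> (int \<Rightarrow> real \<Rightarrow> 'w \<Rightarrow> 'a) \<Rightarrow> bool" where
  "locally_stationary M X Y \<longleftrightarrow>
     (\<forall>T\<ge>1. \<forall>t. X t T \<in> borel_measurable M) \<and>
     (\<forall>T\<ge>1. \<forall>t\<le>0. X t T = X 1 T) \<and>
     (\<forall>T\<ge>1. \<forall>t\<ge>int T. X t T = X (int T) T) \<and>
     (\<forall>u\<in>{0..1}. stationary_process M (\<lambda>t. Y t u)) \<and>
     (\<exists>C. \<forall>T\<ge>1. \<forall>t\<in>{1..int T}.
        (\<integral>\<omega>. min (dist (X t T \<omega>) (Y t (real_of_int t / real T) \<omega>)) 1 \<partial>M) \<le> C * (1 / real T)) \<and>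
     (\<exists>C. \<forall>t\<ge>1. \<forall>u\<in>{0..1}. \<forall>v\<in>{0..1}.
        (\<integral>\<omega>. min (dist (Y t u \<omega>) (Y t v \<omega>)) 1 \<partial>M) \<le> C * \<bar>u - v\<bar>)"

subsection \<open>The bounded Lipschitz distance\<close>

text \<open>
  The norm takes values in \<open>ennreal\<close>, so \<open>BL_norm f \<le> 1\<close> includes that \<open>f\<close> is bounded and Lipschitz,
  and the Lipschitz constant on a one-point space is \<open>Sup {} = 0\<close>.
\<close>

definition BL_norm :: "('a::metric_space \<Rightarrow> real) \<Rightarrow> ennreal" where
  "BL_norm f = (SUP x. ennreal \<bar>f x\<bar>) +
     (SUP (x, y) \<in> {(x, y). x \<noteq> y}. ennreal (\<bar>f x - f y\<bar> / dist x y))"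

text \<open>For Borel measures of total mass at most 1, the supremum is over a set bounded by 2.\<close>

definition d_BL :: "'a::metric_space measure \<Rightarrow> 'a measure \<Rightarrow> real" where
  "d_BL \<mu> \<nu> = (SUP f \<in> {f. BL_norm f \<le> 1}. \<bar>(\<integral>x. f x \<partial>\<mu>) - (\<integral>x. f x \<partial>\<nu>)\<bar>)"

subsection \<open>The partial empirical measure and its limit\<close>

definition emp_measure ::
  "(int \<Rightarrow> nat \<Rightarrow> 'w \<Rightarrow> 'a::topological_space) \<Rightarrow> nat \<Rightarrow> real \<Rightarrow> 'w \<Rightarrow> 'a measure" where
  "emp_measure X T u \<omega> = measure_of UNIV (sets borel)
     (\<lambda>A. ennreal (1 / real T) * (\<Sum>t = 1..\<lfloor>u * real T\<rfloor>. emeasure (return borel (X t T \<omega>)) A))"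

definition limit_measure ::
  "'w measure \<Rightarrow> (int \<Rightarrow> real \<Rightarrow> 'w \<Rightarrow> 'a::topological_space) \<Rightarrow> real \<Rightarrow> 'a measure" where
  "limit_measure M Y u = measure_of UNIV (sets borel)
     (\<lambda>A. \<integral>\<^sup>+\<eta>\<in>{0..u}. emeasure M {\<omega> \<in> space M. Y 0 \<eta> \<omega> \<in> A} \<partial>lborel)"

text \<open>
  \<open>measure_of\<close> yields the null measure unless the given set function is countably additive. The lemmas
  below show that it is. The measurability in \<open>\<eta>\<close> assumed in the second holds for locally
  stationary processes, where the law of \<open>Y 0 \<eta>\<close>, which is that of \<open>Y 1 \<eta>\<close>, depends on \<open>\<eta> \<in> {0..1}\<close>
  continuously with respect to weak convergence.
\<close>

lemma sets_emp_measure: "sets (emp_measure X T u \<omega>) = sets borel"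
  unfolding emp_measure_def by (rule sets.sets_measure_of_eq[of borel, unfolded space_borel])

lemma sets_limit_measure: "sets (limit_measure M Y u) = sets borel"
  unfolding limit_measure_def by (rule sets.sets_measure_of_eq[of borel, unfolded space_borel])

lemma emeasure_emp_measure:
  assumes "A \<in> sets borel"
  shows "emeasure (emp_measure X T u \<omega>) A =
    ennreal (1 / real T) * (\<Sum>t = 1..\<lfloor>u * real T\<rfloor>. emeasure (return borel (X t T \<omega>)) A)"
proof (rule emeasure_measure_of[OF emp_measure_def])
  show "countably_additive (sets (emp_measure X T u \<omega>))
     (\<lambda>A. ennreal (1 / real T) * (\<Sum>t = 1..\<lfloor>u * real T\<rfloor>. emeasure (return borel (X t T \<omega>)) A))"
  proof (rule countably_additiveI, goal_cases)
    case (1 B)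
    then have B: "range B \<subseteq> sets borel"
      by (simp add: sets_emp_measure)
    have "(\<Sum>i. emeasure (return borel (X t T \<omega>)) (B i)) = emeasure (return borel (X t T \<omega>)) (\<Union>i. B i)" for t
      using B 1(2) by (intro suminf_emeasure) auto
    then have "(\<Sum>t\<in>I. emeasure (return borel (X t T \<omega>)) (\<Union>i. B i)) =
        (\<Sum>i. \<Sum>t\<in>I. emeasure (return borel (X t T \<omega>)) (B i))" for I
      by (simp only: suminf_sum[OF summableI])
    then show ?case
      by (simp only: ennreal_suminf_cmult)
  qed
next
  show "sets borel \<subseteq> Pow UNIV"
    by simp
qed (simp_all add: assms positive_def sets_emp_measure)

lemma emeasure_limit_measure:
  assumes "A \<in> sets borel"
    and Y: "\<And>\<eta>. \<eta> \<in> {0..u} \<Longrightarrow> Y 0 \<eta> \<in> borel_measurable M"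
    and meas: "\<And>B. B \<in> sets borel \<Longrightarrow>
      (\<lambda>\<eta>. emeasure M {\<omega> \<in> space M. Y 0 \<eta> \<omega> \<in> B} * indicator {0..u} \<eta>) \<in> borel_measurable lborel"
  shows "emeasure (limit_measure M Y u) A =
    (\<integral>\<^sup>+\<eta>\<in>{0..u}. emeasure M {\<omega> \<in> space M. Y 0 \<eta> \<omega> \<in> A} \<partial>lborel)"
proof (rule emeasure_measure_of[OF limit_measure_def])
  show "countably_additive (sets (limit_measure M Y u))
     (\<lambda>A. \<integral>\<^sup>+\<eta>\<in>{0..u}. emeasure M {\<omega> \<in> space M. Y 0 \<eta> \<omega> \<in> A} \<partial>lborel)"
  proof (rule countably_additiveI, goal_cases)
    case (1 B)
    then have B: "range B \<subseteq> sets borel"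
      by (simp add: sets_limit_measure)
    have *: "(\<Sum>i. emeasure M {\<omega> \<in> space M. Y 0 \<eta> \<omega> \<in> B i}) =
        emeasure M {\<omega> \<in> space M. Y 0 \<eta> \<omega> \<in> (\<Union>i. B i)}" if "\<eta> \<in> {0..u}" for \<eta>
    proof -
      have law: "emeasure M {\<omega> \<in> space M. Y 0 \<eta> \<omega> \<in> C} = emeasure (distr M borel (Y 0 \<eta>)) C"
        if "C \<in> sets borel" for C
        using Y[OF \<open>\<eta> \<in> {0..u}\<close>] that by (subst emeasure_distr) (auto intro!: arg_cong[of _ _ "emeasure M"])
      have "(\<Union>i. B i) \<in> sets borel"
        using B by (rule sets.countable_UN)
      moreover have "(\<Sum>i. emeasure (distr M borel (Y 0 \<eta>)) (B i)) =
          emeasure (distr M borel (Y 0 \<eta>)) (\<Union>i. B i)"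
        using B 1(2) by (intro suminf_emeasure) auto
      moreover have "B i \<in> sets borel" for i
        using B by blast
      ultimately show ?thesis
        by (simp only: law)
    qed
    have "(\<Sum>i. \<integral>\<^sup>+\<eta>\<in>{0..u}. emeasure M {\<omega> \<in> space M. Y 0 \<eta> \<omega> \<in> B i} \<partial>lborel) =
        (\<integral>\<^sup>+\<eta>. (\<Sum>i. emeasure M {\<omega> \<in> space M. Y 0 \<eta> \<omega> \<in> B i} * indicator {0..u} \<eta>) \<partial>lborel)"
      using B by (intro nn_integral_suminf[symmetric] meas) auto
    also have "\<dots> = (\<integral>\<^sup>+\<eta>\<in>{0..u}. emeasure M {\<omega> \<in> space M. Y 0 \<eta> \<omega> \<in> (\<Union>i. B i)} \<partial>lborel)"
      by (intro nn_integral_cong) (simp add: * split: split_indicator)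
    finally show ?case .
  qed
next
  show "sets borel \<subseteq> Pow UNIV"
    by simp
qed (simp_all add: assms(1) positive_def sets_limit_measure)

subsection \<open>Convergence in probability\<close>

text \<open>
  Measurability is part of the definition because \<open>measure\<close> is 0 on non-measurable sets.
\<close>

definition tendsto_in_prob :: "'w measure \<Rightarrow> (nat \<Rightarrow> 'w \<Rightarrow> real) \<Rightarrow> real \<Rightarrow> bool" where
  "tendsto_in_prob M Z c \<longleftrightarrow>
     (\<forall>n. Z n \<in> borel_measurable M) \<and>
     (\<forall>\<epsilon>>0. (\<lambda>n. measure M {\<omega> \<in> space M. \<bar>Z n \<omega> - c\<bar> > \<epsilon>}) \<longlonglongrightarrow> 0)"

end

theory Submission
  imports Defs
begin

text \<open>
  Only finitely many stationary processes matter. Round the rescaled time \<open>t / T\<close> down to a grid of mesh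
  \<open>1 / m\<close> and replace \<open>X t T\<close> by the auxiliary process at the grid point. By local stationarity and since
  a test function \<open>f\<close> with \<open>BL_norm f \<le> 1\<close> satisfies \<open>\<bar>f x - f y\<bar> \<le> 2 * min (dist x y) 1\<close>, this costs
  \<open>O(1 / m + 1 / T)\<close> in mean, uniformly in \<open>f\<close> and \<open>u\<close>. On each of the \<open>m\<close> blocks the sample now comes from
  one stationary ergodic process, whose centred averages vanish as \<open>T\<close> grows. What remains of the
  centring is a Riemann sum of \<open>\<eta> \<mapsto> E (f (Y 0 \<eta>))\<close>, a Lipschitz function, whose integral over \<open>[0, u]\<close> is
  the integral of \<open>f\<close> against the limit measure. Letting first \<open>T\<close> and then \<open>m\<close> tend to infinity, Markov's
  inequality concludes.

  Two uniformities have to be secured. For the supremum over \<open>u\<close>, Birkhoff's theorem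
  (\<open>birkhoff_ergodic\<close>) is strengthened to the maximum over all initial segments
  (\<open>ergodic_process_maximal_averages\<close>). For the supremum over \<open>f\<close>, the space is partitioned into
  countably many Borel sets of small diameter; up to small mass finitely many suffice, and on those
  every \<open>f\<close> is almost constant, so that the ergodic theorem is needed for finitely many indicators only
  (\<open>ergodic_process_BL_averages\<close>). \<open>grid_coupling_bound\<close> combines these bounds for a fixed outcome, and
  \<open>sup_d_BL_bound_in_mean\<close> takes expectations.
\<close>

section \<open>The ergodic theorem\<close>

text \<open>
  Garsia's argument. The event that the partial sums \<open>S n\<close> are unbounded above is exactly invariant,
  so by ergodicity it suffices that it does not have probability 1. The running maxima
  \<open>m n x = max {0, S 1 x, \<dots>, S n x}\<close> satisfy \<open>m (n + 1) x - m n (T x) = max (- m n (T x)) (f x)\<close>. Where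
  the sums are unbounded this tends to \<open>f x\<close>; its integral is nonnegative, because \<open>m\<close> increases in
  \<open>n\<close> and \<open>T\<close> preserves the measure. If the event had probability 1, dominated convergence would
  thus give \<open>\<integral>f \<ge> 0\<close>.
\<close>

lemma ergodic_sums_bounded_above:
  fixes f :: "'a \<Rightarrow> real"
  assumes "prob_space M"
    and T [measurable]: "T \<in> measurable M M"
    and inv: "distr M M T = M"
    and erg: "\<And>B. B \<in> sets M \<Longrightarrow> T -` B \<inter> space M = B \<Longrightarrow> measure M B = 0 \<or> measure M B = 1"
    and f: "integrable M f"
    and neg: "integral\<^sup>L M f < 0"
  shows "AE x in M. \<exists>K. \<forall>n. (\<Sum>i<n. f ((T ^^ i) x)) \<le> K"
proof -
  interpret prob_space M by fact
  have [measurable]: "f \<in> borel_measurable M"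
    using f by auto
  define S where "S n x = (\<Sum>i<n. f ((T ^^ i) x))" for n x
  have S_Suc: "S (Suc n) x = f x + S n (T x)" for n x
    unfolding S_def by (simp add: sum.lessThan_Suc_shift funpow_swap1 del: sum.lessThan_Suc)
  have [measurable]: "S n \<in> borel_measurable M" for n
  proof (induction n)
    case (Suc n)
    then show ?case
      unfolding S_Suc[abs_def] by measurable
  qed (simp add: S_def[abs_def])
  define B where "B = {x \<in> space M. \<forall>K::nat. \<exists>n. S n x > real K}"
  have B_iff: "x \<in> B \<longleftrightarrow> x \<in> space M \<and> (\<forall>K. \<exists>n. S n x > K)" for x
    unfolding B_def by (smt (verit) mem_Collect_eq reals_Archimedean2)
  have B [measurable]: "B \<in> sets M"
    unfolding B_def by measurable
  have TB: "T x \<in> B \<longleftrightarrow> x \<in> B" if x: "x \<in> space M" for x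
  proof -
    have "(\<forall>K. \<exists>n. S n (T x) > K) \<longleftrightarrow> (\<forall>K. \<exists>n. S n x > K)"
    proof safe
      fix K assume "\<forall>K. \<exists>n. S n (T x) > K"
      then obtain n where "S n (T x) > K - f x" by blast
      then show "\<exists>n. S n x > K"
        by (intro exI[of _ "Suc n"]) (simp add: S_Suc)
    next
      fix K assume "\<forall>K. \<exists>n. S n x > K"
      then obtain n where n: "S n x > max 0 (K + f x)" by blast
      then obtain n' where "n = Suc n'"
        by (cases n) (auto simp: S_def)
      with n show "\<exists>n. S n (T x) > K"
        by (intro exI[of _ n']) (simp add: S_Suc)
    qed
    then show ?thesis
      using x measurable_space[OF T x] by (simp add: B_iff)
  qed
  have "prob B = 0 \<or> prob B = 1"
    using TB B sets.sets_into_space[OF B] by (intro erg) (auto simp: B_iff)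
  moreover have "prob B \<noteq> 1"
  proof
    assume "prob B = 1"
    then have AEB: "AE x in M. x \<in> B"
      using prob_eq_1[of B] by simp
    define m where "m = rec_nat (\<lambda>x. 0) (\<lambda>n h x. max 0 (f x + h (T x)))"
    have m0: "m 0 x = 0" and mS: "m (Suc n) x = max 0 (f x + m n (T x))" for n x
      by (simp_all add: m_def)
    have integrable_comp: "integrable M (\<lambda>x. h (T x))" "(\<integral>x. h (T x) \<partial>M) = integral\<^sup>L M h"
      if h: "integrable M h" for h :: "'a \<Rightarrow> real"
    proof -
      have "integrable (distr M M T) h"
        using h inv by simp
      then show "integrable M (\<lambda>x. h (T x))"
        using h by (subst (asm) integrable_distr_eq) auto
      show "(\<integral>x. h (T x) \<partial>M) = integral\<^sup>L M h"
        using integral_distr[of T M M h] h inv by auto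
    qed
    have int_m: "integrable M (m n)" for n
    proof (induction n)
      case 0
      then show ?case by (simp add: m0[abs_def])
    next
      case (Suc n)
      then show ?case
        unfolding mS[abs_def] using integrable_comp(1)[OF Suc] f
        by (intro integrable_max Bochner_Integration.integrable_add) auto
    qed
    have m_mono: "m n x \<le> m (Suc n) x" for n x
      by (induction n arbitrary: x) (auto simp: m0 mS[of "Suc _"] mS intro: max.coboundedI2)
    have m_nonneg: "0 \<le> m n x" for n x
      by (cases n) (auto simp: m0 mS)
    have S_le_m: "S n x \<le> m n x" for n x
      by (induction n arbitrary: x) (auto simp: m0 mS S_Suc S_def[of 0] intro: max.coboundedI2)
    define D where "D n x = max (- m n (T x)) (f x)" for n x
    have D: "D n x = m (Suc n) x - m n (T x)" for n x
      by (simp add: D_def mS max_def)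
    have "(\<lambda>n. \<integral>x. D n x \<partial>M) \<longlonglongrightarrow> integral\<^sup>L M f"
    proof (rule integral_dominated_convergence[where w = "\<lambda>x. \<bar>f x\<bar>"])
      show "AE x in M. (\<lambda>n. D n x) \<longlonglongrightarrow> f x"
        using AEB
      proof eventually_elim
        case (elim x)
        then have "T x \<in> B"
          using TB by (simp add: B_iff)
        then obtain N where N: "S N (T x) > - f x"
          unfolding B_iff by blast
        have "D n x = f x" if "n \<ge> N" for n
        proof -
          have "m N (T x) \<le> m n (T x)"
            using that by (rule lift_Suc_mono_le[of "\<lambda>n. m n (T x)", OF m_mono])
          then show ?thesis
            using N S_le_m[of N "T x"] by (simp add: D_def)
        qed
        then show ?case
          by (intro tendsto_eventually) (auto simp: eventually_sequentially)
      qed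
      show "AE x in M. norm (D n x) \<le> \<bar>f x\<bar>" for n
        using m_nonneg[of n "T _"] by (intro AE_I2) (smt (verit) D_def real_norm_def)
      show "D n \<in> borel_measurable M" for n
        unfolding D_def using int_m by measurable
    qed (use f in auto)
    moreover have "(\<integral>x. D n x \<partial>M) \<ge> 0" for n
    proof -
      have "(\<integral>x. D n x \<partial>M) = integral\<^sup>L M (m (Suc n)) - integral\<^sup>L M (m n)"
        unfolding D using integrable_comp[OF int_m[of n]] int_m[of "Suc n"]
        by (subst Bochner_Integration.integral_diff) auto
      also have "\<dots> \<ge> 0"
        using integral_mono[OF int_m int_m m_mono] by simp
      finally show ?thesis .
    qed
    ultimately show False
      using neg LIMSEQ_le_const[of "\<lambda>n. \<integral>x. D n x \<partial>M" "integral\<^sup>L M f" 0] by auto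
  qed
  ultimately have "prob B = 0" by blast
  then have "AE x in M. x \<notin> B"
    using prob_eq_0[of B] by simp
  then show ?thesis
    by (rule AE_mp) (auto intro!: AE_I2 simp: B_iff S_def not_less)
qed

text \<open>
  The preceding lemma is applied to \<open>f - \<integral>f - \<delta>\<close> and \<open>\<integral>f - f - \<delta>\<close>, which have integral \<open>- \<delta> < 0\<close>: their
  partial sums are bounded above, so the averages of \<open>f\<close> are eventually within \<open>2 \<delta>\<close> of the mean.
\<close>

theorem birkhoff_ergodic:
  fixes f :: "'a \<Rightarrow> real"
  assumes "prob_space M"
    and T: "T \<in> measurable M M"
    and inv: "distr M M T = M"
    and erg: "\<And>B. B \<in> sets M \<Longrightarrow> T -` B \<inter> space M = B \<Longrightarrow> measure M B = 0 \<or> measure M B = 1"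
    and f: "integrable M f"
  shows "AE x in M. (\<lambda>n. (\<Sum>i<n. f ((T ^^ i) x)) / real n) \<longlonglongrightarrow> integral\<^sup>L M f"
proof -
  interpret prob_space M by fact
  define c where "c = integral\<^sup>L M f"
  define e where "e k = 1 / real (Suc k)" for k
  have e: "e k > 0" for k by (simp add: e_def)
  have up: "AE x in M. \<forall>k. \<exists>K. \<forall>n. (\<Sum>i<n. f ((T ^^ i) x) - c - e k) \<le> K"
    unfolding AE_all_countable
    using e f by (intro allI ergodic_sums_bounded_above[OF assms(1-4)]) (auto simp: c_def prob_space)
  have low: "AE x in M. \<forall>k. \<exists>K. \<forall>n. (\<Sum>i<n. c - f ((T ^^ i) x) - e k) \<le> K"
    unfolding AE_all_countable
    using e f by (intro allI ergodic_sums_bounded_above[OF assms(1-4)]) (auto simp: c_def prob_space)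
  show ?thesis
    using up low
  proof eventually_elim
    case (elim x)
    define s where "s n = (\<Sum>i<n. f ((T ^^ i) x))" for n
    have "(\<lambda>n. s n / real n) \<longlonglongrightarrow> c"
    proof (rule LIMSEQ_I)
      fix r :: real assume "r > 0"
      then obtain k where k: "e k < r / 2"
        unfolding e_def using nat_approx_posE[of "r / 2"] by auto
      obtain K1 where K1: "\<And>n. (\<Sum>i<n. f ((T ^^ i) x) - c - e k) \<le> K1" using elim(1) by blast
      obtain K2 where K2: "\<And>n. (\<Sum>i<n. c - f ((T ^^ i) x) - e k) \<le> K2" using elim(2) by blast
      define K where "K = max 1 (max K1 K2)"
      obtain N where N: "real N > K * 2 / r" using reals_Archimedean2 by blast
      have "norm (s n / real n - c) < r" if n: "n \<ge> max 1 N" for n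
      proof -
        have n0: "real n > 0" "real n \<ge> real N" using n by auto
        have "s n - real n * c - real n * e k \<le> K" "real n * c - s n - real n * e k \<le> K"
          using K1[of n] K2[of n] unfolding K_def s_def by (simp_all add: sum_subtractf)
        then have "\<bar>s n - real n * c\<bar> \<le> K + real n * e k" by linarith
        moreover have "K < real n * (r / 2)"
        proof -
          have "K < real N * (r / 2)"
            using N \<open>r > 0\<close> by (simp add: field_simps)
          also have "\<dots> \<le> real n * (r / 2)"
            using n0 \<open>r > 0\<close> by (intro mult_right_mono) auto
          finally show ?thesis .
        qed
        moreover have "real n * e k < real n * (r / 2)"
          using k n0 by simp
        ultimately have "\<bar>s n - real n * c\<bar> < real n * r" by (simp add: field_simps)
        then have "\<bar>s n - real n * c\<bar> / real n < r"
          using n0 by (simp add: field_simps)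
        moreover have "s n / real n - c = (s n - real n * c) / real n"
          using n0 by (simp add: field_simps)
        ultimately show ?thesis by simp
      qed
      then show "\<exists>no. \<forall>n\<ge>no. norm (s n / real n - c) < r" by blast
    qed
    then show ?case by (simp add: s_def c_def)
  qed
qed

text \<open>
  Birkhoff's theorem for the shift on path space. The time index starts at 1, the first sample point,
  so the observable is the coordinate at 1, which is the coordinate at 0 after one shift.
\<close>

lemma ergodic_process_averages:
  fixes Z :: "int \<Rightarrow> 'w \<Rightarrow> 'a::topological_space" and g :: "'a \<Rightarrow> real"
  assumes "prob_space M" and Z: "stationary_process M Z" and erg: "ergodic_process M Z"
    and g [measurable]: "g \<in> borel_measurable borel" and bound: "\<And>x. \<bar>g x\<bar> \<le> b"
  shows "AE \<omega> in M. (\<lambda>n. (\<Sum>s<n. g (Z (int s + 1) \<omega>)) / real n) \<longlonglongrightarrow> (\<integral>\<omega>. g (Z 0 \<omega>) \<partial>M)"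
proof -
  interpret prob_space M by fact
  let ?S = "Pi\<^sub>M UNIV (\<lambda>_::int. borel :: 'a measure)"
  have Zm [measurable]: "Z t \<in> borel_measurable M" for t
    using Z by (simp add: stationary_process_def)
  have path [measurable]: "(\<lambda>\<omega> t. Z (t + h) \<omega>) \<in> measurable M ?S" for h
    by (intro measurable_PiM_single') auto
  have path0 [measurable]: "(\<lambda>\<omega> t. Z t \<omega>) \<in> measurable M ?S"
    by (intro measurable_PiM_single') auto
  define P where "P = process_law M Z"
  have P: "P = distr M ?S (\<lambda>\<omega> t. Z t \<omega>)" by (simp add: P_def process_law_def)
  have sP [measurable_cong]: "sets P = sets ?S" by (simp add: P)
  have spP: "space P = UNIV" by (simp add: P space_PiM)
  have "prob_space P" unfolding P by (rule prob_space_distr) simp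
  then interpret P: prob_space P .
  have coord: "(\<lambda>x. x t) \<in> measurable P borel" for t
    by measurable
  have shift: "shift \<in> measurable P P"
  proof -
    have "(\<lambda>x t. x (t + 1)) \<in> measurable P ?S"
      by (intro measurable_PiM_single') (auto simp: spP intro: coord)
    then show ?thesis by (simp add: shift_def[abs_def] measurable_cong_sets[OF refl sP])
  qed
  have "distr P P shift = distr P ?S shift"
    by (rule distr_cong) (auto simp: sP)
  also have "\<dots> = distr M ?S (shift \<circ> (\<lambda>\<omega> t. Z t \<omega>))"
    unfolding P using shift by (intro distr_distr) (simp_all add: measurable_cong_sets[OF sP sP])
  also have "\<dots> = process_law M (\<lambda>t. Z (t + 1))"
    by (simp add: process_law_def shift_def comp_def)
  also have "\<dots> = P"
    using Z by (simp add: stationary_process_def P_def)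
  finally have inv: "distr P P shift = P" .
  have gx: "(\<lambda>x. g (x t)) \<in> borel_measurable P" for t
    using coord by measurable
  have int: "integrable P (\<lambda>x. g (x 1))"
    using bound by (intro P.integrable_const_bound[where B = b] gx) auto
  have it: "(shift ^^ i) x = (\<lambda>t. x (t + int i))" for i and x :: "int \<Rightarrow> 'a"
    by (induction i arbitrary: x) (auto simp: shift_def algebra_simps)
  have E: "(\<integral>x. g (x t) \<partial>P) = (\<integral>\<omega>. g (Z t \<omega>) \<partial>M)" for t
    using gx[of t] by (simp add: P integral_distr)
  have "(\<integral>x. g (x 1) \<partial>P) = (\<integral>x. g (shift x 0) \<partial>P)"
    by (simp add: shift_def)
  also have "\<dots> = (\<integral>x. g (x 0) \<partial>distr P P shift)"
    by (rule integral_distr[symmetric]) (auto intro: shift gx)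
  finally have E1: "(\<integral>x. g (x 1) \<partial>P) = (\<integral>\<omega>. g (Z 0 \<omega>) \<partial>M)"
    by (simp add: inv E)
  have "AE x in P. (\<lambda>n. (\<Sum>i<n. g ((shift ^^ i) x 1)) / real n) \<longlonglongrightarrow> (\<integral>x. g (x 1) \<partial>P)"
    using erg by (intro birkhoff_ergodic[OF \<open>prob_space P\<close> shift inv _ int])
       (auto simp: ergodic_process_def P_def[symmetric] spP)
  then have "AE x in P. (\<lambda>n. (\<Sum>s<n. g (x (int s + 1))) / real n) \<longlonglongrightarrow> (\<integral>\<omega>. g (Z 0 \<omega>) \<partial>M)"
    by (simp add: it E1 add.commute)
  then show ?thesis
    unfolding P by (rule AE_distrD[OF path0])
qed

section \<open>Averages of an ergodic process, uniformly over bounded Lipschitz functions\<close>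

text \<open>
  The ergodic theorem controls sums over a full initial segment. This upgrade to the maximum over all
  shorter segments makes the later estimates uniform in the truncation point \<open>\<lfloor>u T\<rfloor>\<close>, and
  it controls sums over any intermediate block as differences of two initial segments.
\<close>

lemma max_partial_sums_negligible:
  fixes a :: "nat \<Rightarrow> real"
  assumes "(\<lambda>n. a n / real n) \<longlonglongrightarrow> 0"
  shows "(\<lambda>n. (MAX k\<in>{..n}. \<bar>a k\<bar>) / real n) \<longlonglongrightarrow> 0"
proof (rule LIMSEQ_I)
  fix r :: real assume r: "r > 0"
  obtain N where N: "\<And>n. n \<ge> N \<Longrightarrow> \<bar>a n / real n\<bar> < r / 2"
    using LIMSEQ_D[OF assms, of "r / 2"] r by auto
  define K where "K = (MAX k\<in>{..N}. \<bar>a k\<bar>)"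
  obtain N' where N': "real N' > 2 * K / r"
    using reals_Archimedean2 by blast
  have "norm ((MAX k\<in>{..n}. \<bar>a k\<bar>) / real n - 0) < r" if n: "n \<ge> max 1 N'" for n
  proof -
    have n0: "real n > 0" "real n \<ge> real N'" using n by auto
    have "\<bar>a k\<bar> \<le> real n * (r / 2)" if "k \<le> n" for k
    proof (cases "k \<le> N")
      case True
      then have "\<bar>a k\<bar> \<le> K"
        unfolding K_def by (intro Max_ge) auto
      also have "K \<le> real N' * (r / 2)"
        using N' r by (simp add: field_simps)
      also have "\<dots> \<le> real n * (r / 2)"
        using n0 r by (intro mult_right_mono) auto
      finally show ?thesis .
    next
      case False
      then have k0: "real k > 0" by simp
      have "\<bar>a k\<bar> / real k < r / 2"
        using N[of k] False by simp
      then have "\<bar>a k\<bar> < real k * (r / 2)"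
        using k0 by (simp add: field_simps)
      also have "\<dots> \<le> real n * (r / 2)"
        using that r by (intro mult_right_mono) auto
      finally show ?thesis by simp
    qed
    then have "(MAX k\<in>{..n}. \<bar>a k\<bar>) \<le> real n * (r / 2)"
      by (intro Max.boundedI) auto
    then have "(MAX k\<in>{..n}. \<bar>a k\<bar>) / real n \<le> r / 2"
      using n0 by (simp add: field_simps)
    moreover have "0 \<le> (MAX k\<in>{..n}. \<bar>a k\<bar>)"
      by (rule Max_ge_iff[THEN iffD2]) auto
    ultimately have "norm ((MAX k\<in>{..n}. \<bar>a k\<bar>) / real n - 0) \<le> r / 2"
      using n0 by (simp add: abs_of_nonneg)
    then show ?thesis
      using r by linarith
  qed
  then show "\<exists>no. \<forall>n\<ge>no. norm ((MAX k\<in>{..n}. \<bar>a k\<bar>) / real n - 0) < r" by blast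
qed

lemma BL_norm_le_1D:
  assumes "BL_norm f \<le> 1"
  shows "\<bar>f x\<bar> \<le> 1" and "\<bar>f x - f y\<bar> \<le> dist x y"
proof -
  have "(SUP x. ennreal \<bar>f x\<bar>) \<le> 1"
    using assms unfolding BL_norm_def by (meson add_increasing2 dual_order.trans le_iff_add)
  then show "\<bar>f x\<bar> \<le> 1"
    by (simp add: SUP_le_iff)
  have "(SUP (x, y) \<in> {(x, y). x \<noteq> y}. ennreal (\<bar>f x - f y\<bar> / dist x y)) \<le> 1"
    using assms unfolding BL_norm_def by (metis (no_types, lifting) add.commute dual_order.trans le_iff_add)
  then have "\<bar>f x - f y\<bar> / dist x y \<le> 1" if "x \<noteq> y"
    using that by (auto simp: SUP_le_iff)
  then show "\<bar>f x - f y\<bar> \<le> dist x y"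
    by (cases "x = y") (auto simp: field_simps)
qed

lemma BL_norm_zero: "BL_norm (\<lambda>_. 0) \<le> 1"
proof -
  have "(SUP (x, y) \<in> {(x :: 'a, y). x \<noteq> y}. ennreal (\<bar>0 - 0\<bar> / dist x y)) \<le> 0"
    by (rule SUP_least) auto
  then show ?thesis
    unfolding BL_norm_def by simp
qed

lemma BL_min_dist:
  assumes "BL_norm f \<le> 1"
  shows "\<bar>f x - f y\<bar> \<le> 2 * min (dist x y) 1"
  using BL_norm_le_1D(1)[OF assms, of x] BL_norm_le_1D(1)[OF assms, of y]
    BL_norm_le_1D(2)[OF assms, of x y] by (auto simp: min_def)

lemma BL_measurable:
  fixes f :: "'a::metric_space \<Rightarrow> real"
  assumes "BL_norm f \<le> 1"
  shows "f \<in> borel_measurable borel"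
proof (rule borel_measurable_continuous_onI)
  have "1-lipschitz_on UNIV f"
    using BL_norm_le_1D(2)[OF assms] by (intro lipschitz_onI) (auto simp: dist_real_def)
  then show "continuous_on UNIV f"
    by (rule lipschitz_on_continuous_on)
qed

lemma bounded_measurable_compose_integrable:
  fixes g :: "'a::topological_space \<Rightarrow> real"
  assumes "prob_space M" and "W \<in> borel_measurable M"
    and "g \<in> borel_measurable borel" and "\<And>x. \<bar>g x\<bar> \<le> b"
  shows "integrable M (\<lambda>\<omega>. g (W \<omega>))"
proof -
  interpret prob_space M by fact
  show ?thesis
    using assms by (intro integrable_const_bound[where B = b]) auto
qed

text \<open>
  Means are used instead of almost sure limits because the means of several error terms add up and
  Markov's inequality then applies. They converge by domination, as \<open>\<bar>V n\<bar> \<le> 2 * b\<close>.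
\<close>

lemma ergodic_process_maximal_averages:
  fixes Z :: "int \<Rightarrow> 'w \<Rightarrow> 'a::topological_space" and g :: "'a \<Rightarrow> real"
  assumes "prob_space M" and Z: "stationary_process M Z" and erg: "ergodic_process M Z"
    and g [measurable]: "g \<in> borel_measurable borel" and bound: "\<And>x. \<bar>g x\<bar> \<le> b"
  defines "V n \<omega> \<equiv> (MAX k\<in>{..n}. \<bar>\<Sum>s<k. g (Z (int s + 1) \<omega>) - (\<integral>\<omega>. g (Z 0 \<omega>) \<partial>M)\<bar>) / real n"
  shows "integrable M (V n)" and "(\<lambda>n. \<integral>\<omega>. V n \<omega> \<partial>M) \<longlonglongrightarrow> 0"
proof -
  interpret prob_space M by fact
  define c where "c = (\<integral>\<omega>. g (Z 0 \<omega>) \<partial>M)"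
  have Zm [measurable]: "Z t \<in> borel_measurable M" for t
    using Z by (simp add: stationary_process_def)
  have V: "V n \<omega> = (MAX k\<in>{..n}. \<bar>\<Sum>s<k. g (Z (int s + 1) \<omega>) - c\<bar>) / real n" for n \<omega>
    by (simp add: V_def c_def)
  have b: "b \<ge> 0"
    using bound[of undefined] by linarith
  have "\<bar>c\<bar> \<le> b"
  proof -
    have "\<bar>c\<bar> \<le> (\<integral>\<omega>. \<bar>g (Z 0 \<omega>)\<bar> \<partial>M)"
      unfolding c_def by (rule integral_abs_bound)
    also have "\<dots> \<le> (\<integral>\<omega>. b \<partial>M)"
      using bound by (intro integral_mono integrable_abs
          bounded_measurable_compose_integrable[OF \<open>prob_space M\<close> Zm g bound]) auto
    finally show ?thesis by (simp add: prob_space)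
  qed
  have V_meas [measurable]: "V n \<in> borel_measurable M" for n
    unfolding V[abs_def] by measurable
  have V_bound: "norm (V n \<omega>) \<le> 2 * b" for n \<omega>
  proof -
    have "\<bar>\<Sum>s<k. g (Z (int s + 1) \<omega>) - c\<bar> \<le> 2 * b * real n" if "k \<le> n" for k
    proof -
      have "\<bar>\<Sum>s<k. g (Z (int s + 1) \<omega>) - c\<bar> \<le> (\<Sum>s<k. \<bar>g (Z (int s + 1) \<omega>) - c\<bar>)"
        by (rule sum_abs)
      also have "\<dots> \<le> (\<Sum>s<k. 2 * b)"
      proof (rule sum_mono)
        fix s
        show "\<bar>g (Z (int s + 1) \<omega>) - c\<bar> \<le> 2 * b"
          using bound[of "Z (int s + 1) \<omega>"] \<open>\<bar>c\<bar> \<le> b\<close> by linarith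
      qed
      also have "\<dots> \<le> 2 * b * real n"
        using that b mult_right_mono[of "real k" "real n" "2 * b"] by (simp add: mult.commute)
      finally show ?thesis .
    qed
    then have "(MAX k\<in>{..n}. \<bar>\<Sum>s<k. g (Z (int s + 1) \<omega>) - c\<bar>) \<le> 2 * b * real n"
      by (intro Max.boundedI) auto
    moreover have "0 \<le> (MAX k\<in>{..n}. \<bar>\<Sum>s<k. g (Z (int s + 1) \<omega>) - c\<bar>)"
      by (rule Max_ge_iff[THEN iffD2]) auto
    ultimately show ?thesis
      unfolding V using b by (cases "n = 0") (auto simp: field_simps)
  qed
  show "integrable M (V n)"
    using V_bound by (intro integrable_const_bound[where B = "2 * b"]) auto
  have "(\<lambda>n. \<integral>\<omega>. V n \<omega> \<partial>M) \<longlonglongrightarrow> (\<integral>\<omega>. 0 \<partial>M)"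
  proof (rule integral_dominated_convergence[where w = "\<lambda>_. 2 * b"])
    show "AE \<omega> in M. (\<lambda>n. V n \<omega>) \<longlonglongrightarrow> 0"
      using ergodic_process_averages[OF assms(1-5)]
    proof eventually_elim
      case (elim \<omega>)
      have "(\<lambda>n. (\<Sum>s<n. g (Z (int s + 1) \<omega>) - c) / real n) \<longlonglongrightarrow> 0"
      proof (rule Lim_transform_eventually)
        show "(\<lambda>n. (\<Sum>s<n. g (Z (int s + 1) \<omega>)) / real n - c) \<longlonglongrightarrow> 0"
          using elim by (simp add: LIM_zero_iff c_def)
        show "\<forall>\<^sub>F n in sequentially. (\<Sum>s<n. g (Z (int s + 1) \<omega>)) / real n - c =
            (\<Sum>s<n. g (Z (int s + 1) \<omega>) - c) / real n"
          using eventually_gt_at_top[of 0]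
          by eventually_elim (simp add: sum_subtractf field_simps)
      qed
      then show ?case
        unfolding V by (rule max_partial_sums_negligible)
    qed
  qed (use V_bound in auto)
  then show "(\<lambda>n. \<integral>\<omega>. V n \<omega> \<partial>M) \<longlonglongrightarrow> 0" by simp
qed

text \<open>
  Separability replaces compactness: the balls of radius \<open>\<epsilon>\<close> around a dense sequence cover the space,
  and finitely many of them carry all but \<open>\<epsilon>\<close> of the mass.
\<close>

lemma small_borel_partition:
  fixes \<nu> :: "'a::{metric_space, second_countable_topology} measure"
  assumes "prob_space \<nu>" and sets: "sets \<nu> = sets borel" and \<epsilon>: "\<epsilon> > 0"
  obtains N :: nat and a :: "nat \<Rightarrow> 'a" and A :: "nat \<Rightarrow> 'a set"
  where "\<And>i. A i \<in> sets borel" "disjoint_family A" "\<And>i x. x \<in> A i \<Longrightarrow> dist x (a i) < \<epsilon>"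
    "measure \<nu> (- (\<Union>i<N. A i)) < \<epsilon>"
proof -
  interpret prob_space \<nu> by fact
  obtain D :: "'a set" where D: "countable D" "\<And>X. open X \<Longrightarrow> X \<noteq> {} \<Longrightarrow> \<exists>d\<in>D. d \<in> X"
    using countable_dense_setE by blast
  have "D \<noteq> {}" using D(2)[of UNIV] by auto
  define a where "a = from_nat_into D"
  define B where "B i = ball (a i) \<epsilon>" for i
  define A where "A = disjointed B"
  have A: "range A \<subseteq> sets borel"
    unfolding A_def by (rule sets.range_disjointed_sets) (auto simp: B_def)
  have "\<exists>i. x \<in> B i" for x
  proof -
    obtain d where "d \<in> D" "d \<in> ball x \<epsilon>" using D(2)[of "ball x \<epsilon>"] \<epsilon> by force
    moreover then obtain i where "d = a i"
      unfolding a_def using from_nat_into_surj[OF D(1)] by metis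
    ultimately show ?thesis by (auto simp: B_def dist_commute)
  qed
  then have UN: "(\<Union>i. A i) = UNIV"
    unfolding A_def UN_disjointed_eq by blast
  have "(\<lambda>n. measure \<nu> (\<Union>i<n. A i)) \<longlonglongrightarrow> measure \<nu> (\<Union>n. \<Union>i<n. A i)"
  proof (rule finite_Lim_measure_incseq)
    show "incseq (\<lambda>n. \<Union>i<n. A i)"
      by (intro monoI UN_mono) auto
  qed (use A sets in \<open>auto intro!: sets.finite_UN\<close>)
  also have "(\<Union>n. \<Union>i<n. A i) = space \<nu>"
    using UN sets_eq_imp_space_eq[OF sets] UN_UN_finite_eq[of A] by (simp add: atLeast0LessThan)
  finally have "(\<lambda>n. measure \<nu> (\<Union>i<n. A i)) \<longlonglongrightarrow> 1"
    by (simp add: prob_space)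
  then have "\<forall>\<^sub>F n in sequentially. measure \<nu> (\<Union>i<n. A i) > 1 - \<epsilon>"
    using \<epsilon> by (intro order_tendstoD) auto
  then obtain N where N: "measure \<nu> (\<Union>i<N. A i) > 1 - \<epsilon>"
    by (auto simp: eventually_sequentially)
  have "(\<Union>i<N. A i) \<in> sets \<nu>"
    using A sets by (intro sets.finite_UN) auto
  then have "measure \<nu> (- (\<Union>i<N. A i)) < \<epsilon>"
    using N prob_compl[of "\<Union>i<N. A i"] sets_eq_imp_space_eq[OF sets] by (simp add: Compl_eq_Diff_UNIV)
  moreover have "dist x (a i) < \<epsilon>" if "x \<in> A i" for i x
    using that disjointed_subset[of B i] by (auto simp: A_def B_def dist_commute)
  moreover have "disjoint_family A"
    unfolding A_def by (rule disjoint_family_disjointed)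
  ultimately show ?thesis
    using A by (intro that[of A a N]) auto
qed

text \<open>
  On a partition into small Borel sets, all bounded Lipschitz functions are simultaneously close to
  linear combinations of the same finitely many indicators, with coefficients at most 1. The ergodic
  theorem for these indicators and for that of the rest set \<open>R\<close> therefore yields one random bound \<open>V\<close>
  valid for every \<open>f\<close>, which avoids the measurability of a supremum over \<open>f\<close>.
\<close>

lemma ergodic_process_BL_averages:
  fixes Z :: "int \<Rightarrow> 'w \<Rightarrow> 'a::polish_space"
  assumes "prob_space M" and Z: "stationary_process M Z" and erg: "ergodic_process M Z"
    and \<epsilon>: "\<epsilon> > 0"
  obtains V :: "nat \<Rightarrow> 'w \<Rightarrow> real"
  where "\<And>n. integrable M (V n)" "(\<lambda>n. \<integral>\<omega>. V n \<omega> \<partial>M) \<longlonglongrightarrow> 0"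
    "\<And>n k f \<omega>. n \<ge> 1 \<Longrightarrow> k \<le> n \<Longrightarrow> BL_norm f \<le> 1 \<Longrightarrow>
       \<bar>\<Sum>s<k. f (Z (int s + 1) \<omega>) - (\<integral>\<omega>. f (Z 0 \<omega>) \<partial>M)\<bar> \<le> real n * (\<epsilon> + V n \<omega>)"
proof -
  interpret prob_space M by fact
  have Zm [measurable]: "Z t \<in> borel_measurable M" for t
    using Z by (simp add: stationary_process_def)
  define \<nu> where "\<nu> = distr M borel (Z 0)"
  interpret nu: prob_space \<nu> unfolding \<nu>_def by (rule prob_space_distr) simp
  have s\<nu> [measurable_cong, simp]: "sets \<nu> = sets borel" by (simp add: \<nu>_def)
  have sp\<nu> [simp]: "space \<nu> = UNIV" by (simp add: \<nu>_def)
  have E: "(\<integral>\<omega>. g (Z 0 \<omega>) \<partial>M) = integral\<^sup>L \<nu> g" if "g \<in> borel_measurable borel" for g :: "'a \<Rightarrow> real"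
    using that by (simp add: \<nu>_def integral_distr)
  \<comment> \<open>A quarter of \<open>\<epsilon>\<close> each for the oscillation of \<open>f\<close> on the cells and for the mass of the rest set,
    both of which enter once through the sample and once through the mean.\<close>
  obtain N :: nat and a :: "nat \<Rightarrow> 'a" and A :: "nat \<Rightarrow> 'a set"
    where A [measurable]: "\<And>i. A i \<in> sets borel" and disj: "disjoint_family A"
      and diam: "\<And>i x. x \<in> A i \<Longrightarrow> dist x (a i) < \<epsilon> / 4"
      and rest: "measure \<nu> (- (\<Union>i<N. A i)) < \<epsilon> / 4"
    by (rule small_borel_partition[OF nu.prob_space_axioms s\<nu>, of "\<epsilon> / 4"])
       (use \<epsilon> in simp, rule that)
  define R where "R = - (\<Union>i<N. A i)"
  have R [measurable]: "R \<in> sets borel" unfolding R_def by measurable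
  define v :: "'a set \<Rightarrow> nat \<Rightarrow> 'w \<Rightarrow> real" where "v B n \<omega> =
    (MAX k\<in>{..n}. \<bar>\<Sum>s<k. indicator B (Z (int s + 1) \<omega>) - (\<integral>\<omega>. indicator B (Z 0 \<omega>) \<partial>M)\<bar>) / real n" for B n \<omega>
  have v: "integrable M (v B n)" "(\<lambda>n. \<integral>\<omega>. v B n \<omega> \<partial>M) \<longlonglongrightarrow> 0" if "B \<in> sets borel" for B n
    unfolding v_def[abs_def]
    using ergodic_process_maximal_averages[OF assms(1-3), of "indicator B" 1] that by auto
  have v_bound: "\<bar>\<Sum>s<k. indicator B (Z (int s + 1) \<omega>) - measure \<nu> B\<bar> \<le> real n * v B n \<omega>"
    if "B \<in> sets borel" "n \<ge> 1" "k \<le> n" for B n k \<omega>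
  proof -
    have "(\<integral>\<omega>. indicator B (Z 0 \<omega>) \<partial>M) = measure \<nu> B"
      using that by (subst E) auto
    then show ?thesis
      using that unfolding v_def by (auto intro!: Max_ge)
  qed
  define V where "V n \<omega> = v R n \<omega> + (\<Sum>i<N. v (A i) n \<omega>)" for n \<omega>
  show ?thesis
  proof (rule that[of V])
    show "integrable M (V n)" for n
      unfolding V_def[abs_def] using v(1) by auto
    have "(\<lambda>n. (\<integral>\<omega>. v R n \<omega> \<partial>M) + (\<Sum>i<N. \<integral>\<omega>. v (A i) n \<omega> \<partial>M)) \<longlonglongrightarrow> 0 + (\<Sum>i<N. 0)"
      by (intro tendsto_intros v(2)) auto
    then show "(\<lambda>n. \<integral>\<omega>. V n \<omega> \<partial>M) \<longlonglongrightarrow> 0"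
      unfolding V_def[abs_def] using v(1) by simp
  next
    fix n k :: nat and f :: "'a \<Rightarrow> real" and \<omega>
    assume n: "n \<ge> 1" "k \<le> n" and f: "BL_norm f \<le> 1"
    note [measurable] = BL_measurable[OF f]
    define h where "h x = (\<Sum>i<N. f (a i) * indicator (A i) x)" for x
    have fh: "\<bar>f x - h x\<bar> \<le> \<epsilon> / 4 + indicator R x" for x
    proof (cases "x \<in> R")
      case True
      then have "h x = 0" by (auto simp: h_def R_def)
      then show ?thesis using True BL_norm_le_1D(1)[OF f, of x] \<epsilon> by simp
    next
      case False
      then obtain i where i: "i < N" "x \<in> A i" by (auto simp: R_def)
      have "indicator (A j) x = (if j = i then 1 else 0 :: real)" for j
        using disj i by (auto simp: disjoint_family_on_def indicator_def)
      then have "h x = f (a i)"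
        using i by (simp add: h_def if_distrib[of "\<lambda>x. _ * x"] cong: if_cong)
      then show ?thesis
        using BL_norm_le_1D(2)[OF f, of x "a i"] diam[OF i(2)] False by simp
    qed
    have [measurable]: "h \<in> borel_measurable borel"
      unfolding h_def[abs_def] by measurable
    have int_f: "integrable \<nu> f"
      using BL_norm_le_1D(1)[OF f] by (intro nu.integrable_const_bound[where B = 1]) auto
    have int_ind: "integrable \<nu> (indicator B :: 'a \<Rightarrow> real)" if "B \<in> sets borel" for B
      using that by (intro nu.integrable_const_bound[where B = 1]) (auto simp: indicator_def)
    have int_h: "integrable \<nu> h"
      unfolding h_def[abs_def]
      using int_ind by (intro Bochner_Integration.integrable_sum integrable_mult_right) auto
    have Eh: "integral\<^sup>L \<nu> h = (\<Sum>i<N. f (a i) * measure \<nu> (A i))"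
      unfolding h_def[abs_def]
      by (subst Bochner_Integration.integral_sum) (auto intro!: integrable_mult_right int_ind)
    let ?z = "\<lambda>s. Z (int s + 1) \<omega>"
    \<comment> \<open>The empirical frequency of the rest set is itself controlled by the ergodic theorem for its indicator.\<close>
    have 1: "\<bar>\<Sum>s<k. f (?z s) - h (?z s)\<bar> \<le> real n * (\<epsilon> / 4) + (real n * (\<epsilon> / 4) + real n * v R n \<omega>)"
    proof -
      have "\<bar>\<Sum>s<k. f (?z s) - h (?z s)\<bar> \<le> (\<Sum>s<k. \<epsilon> / 4 + indicator R (?z s))"
        by (rule order_trans[OF sum_abs]) (intro sum_mono fh)
      also have "\<dots> = real k * (\<epsilon> / 4) + (real k * measure \<nu> R + (\<Sum>s<k. indicator R (?z s) - measure \<nu> R))"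
        by (simp add: sum.distrib sum_subtractf)
      also have "\<dots> \<le> real n * (\<epsilon> / 4) + (real n * (\<epsilon> / 4) + real n * v R n \<omega>)"
        using n \<epsilon> rest v_bound[OF R n, of \<omega>]
        by (intro add_mono mult_mono) (auto simp: R_def)
      finally show ?thesis .
    qed
    have 2: "\<bar>\<Sum>s<k. h (?z s) - integral\<^sup>L \<nu> h\<bar> \<le> (\<Sum>i<N. real n * v (A i) n \<omega>)"
    proof -
      have "(\<Sum>s<k. h (?z s) - integral\<^sup>L \<nu> h) =
          (\<Sum>s<k. \<Sum>i<N. f (a i) * (indicator (A i) (?z s) - measure \<nu> (A i)))"
        by (simp add: h_def Eh sum_subtractf algebra_simps)
      also have "\<dots> = (\<Sum>i<N. f (a i) * (\<Sum>s<k. indicator (A i) (?z s) - measure \<nu> (A i)))"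
        by (subst sum.swap) (simp add: sum_distrib_left)
      also have "\<bar>\<dots>\<bar> \<le> (\<Sum>i<N. \<bar>f (a i) * (\<Sum>s<k. indicator (A i) (?z s) - measure \<nu> (A i))\<bar>)"
        by (rule sum_abs)
      also have "\<dots> \<le> (\<Sum>i<N. 1 * (real n * v (A i) n \<omega>))"
        unfolding abs_mult using BL_norm_le_1D(1)[OF f] v_bound[OF A n]
        by (intro sum_mono mult_mono) auto
      finally show ?thesis by simp
    qed
    have 3: "\<bar>integral\<^sup>L \<nu> h - integral\<^sup>L \<nu> f\<bar> \<le> \<epsilon> / 2"
    proof -
      have "\<bar>integral\<^sup>L \<nu> h - integral\<^sup>L \<nu> f\<bar> = \<bar>\<integral>x. f x - h x \<partial>\<nu>\<bar>"
        using int_f int_h by simp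
      also have "\<dots> \<le> (\<integral>x. \<bar>f x - h x\<bar> \<partial>\<nu>)"
        by (rule integral_abs_bound)
      also have "\<dots> \<le> (\<integral>x. \<epsilon> / 4 + indicator R x \<partial>\<nu>)"
        using int_f int_h int_ind fh by (intro integral_mono) auto
      also have "\<dots> = \<epsilon> / 4 + measure \<nu> R"
        using int_ind[OF R] nu.prob_space by (subst Bochner_Integration.integral_add) auto
      finally show ?thesis using rest by (simp add: R_def)
    qed
    have 4: "\<bar>real k * (integral\<^sup>L \<nu> h - integral\<^sup>L \<nu> f)\<bar> \<le> real n * (\<epsilon> / 2)"
      unfolding abs_mult using 3 n \<epsilon> by (intro mult_mono) auto
    have "(\<Sum>s<k. f (?z s) - integral\<^sup>L \<nu> f) = (\<Sum>s<k. f (?z s) - h (?z s))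
        + (\<Sum>s<k. h (?z s) - integral\<^sup>L \<nu> h) + real k * (integral\<^sup>L \<nu> h - integral\<^sup>L \<nu> f)"
      by (simp add: sum_subtractf algebra_simps)
    then have "\<bar>\<Sum>s<k. f (?z s) - integral\<^sup>L \<nu> f\<bar> \<le>
        real n * \<epsilon> + real n * v R n \<omega> + (\<Sum>i<N. real n * v (A i) n \<omega>)"
      using 1 2 4 by linarith
    also have "\<dots> = real n * (\<epsilon> + V n \<omega>)"
      by (simp add: V_def algebra_simps sum_distrib_left)
    finally show "\<bar>\<Sum>s<k. f (?z s) - (\<integral>\<omega>. f (Z 0 \<omega>) \<partial>M)\<bar> \<le> real n * (\<epsilon> + V n \<omega>)"
      by (subst E) auto
  qed
qed

section \<open>Integrals against the empirical measure, and Riemann sums\<close>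

lemma riemann_sum_lipschitz:
  fixes \<phi> :: "real \<Rightarrow> real"
  assumes lip: "\<And>x y. x \<in> {0..1} \<Longrightarrow> y \<in> {0..1} \<Longrightarrow> \<bar>\<phi> x - \<phi> y\<bar> \<le> L * \<bar>x - y\<bar>"
    and cont: "continuous_on {0..1} \<phi>" and L: "L \<ge> 0" and n: "n \<ge> 1"
  shows "k \<le> n \<Longrightarrow> \<bar>integral {0..real k / real n} \<phi> - (\<Sum>s<k. \<phi> (real (s + 1) / real n)) / real n\<bar>
    \<le> real k * (L * (1 / real n)\<^sup>2)"
proof (induction k)
  case (Suc k)
  define a where "a = real k / real n"
  define b where "b = real (Suc k) / real n"
  have ab: "0 \<le> a" "a \<le> b" "b \<le> 1" "b - a = 1 / real n"
    using Suc.prems n by (auto simp: a_def b_def field_simps)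
  have int: "\<phi> integrable_on {c..d}" if "0 \<le> c" "d \<le> 1" for c d
    using that by (intro integrable_continuous_interval continuous_on_subset[OF cont]) auto
  have "integral {0..b} \<phi> = integral {0..a} \<phi> + integral {a..b} \<phi>"
    using ab by (intro Henstock_Kurzweil_Integration.integral_combine[symmetric] int) auto
  moreover have "\<bar>integral {a..b} \<phi> - \<phi> b / real n\<bar> \<le> L * (1 / real n)\<^sup>2"
  proof -
    have "integral {a..b} \<phi> - \<phi> b / real n = integral {a..b} (\<lambda>x. \<phi> x - \<phi> b)"
      using ab by (subst integral_diff) (auto intro: int)
    also have "norm \<dots> \<le> (L * (1 / real n)) * (b - a)"
    proof (rule integral_bound)
      show "continuous_on {a..b} (\<lambda>x. \<phi> x - \<phi> b)"
        using ab by (intro continuous_intros continuous_on_subset[OF cont]) auto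
      show "norm (\<phi> x - \<phi> b) \<le> L * (1 / real n)" if "x \<in> {a..b}" for x
      proof -
        have "\<bar>\<phi> x - \<phi> b\<bar> \<le> L * \<bar>x - b\<bar>"
          using that ab by (intro lip) auto
        also have "\<dots> \<le> L * (1 / real n)"
          using that ab L by (intro mult_left_mono) auto
        finally show ?thesis by simp
      qed
    qed (use ab in auto)
    finally show ?thesis
      using ab by (simp add: power2_eq_square)
  qed
  moreover have "(\<Sum>s<Suc k. \<phi> (real (s + 1) / real n)) / real n =
      (\<Sum>s<k. \<phi> (real (s + 1) / real n)) / real n + \<phi> b / real n"
    by (simp add: b_def add_divide_distrib)
  moreover have "real (Suc k) * (L * (1 / real n)\<^sup>2) = real k * (L * (1 / real n)\<^sup>2) + L * (1 / real n)\<^sup>2"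
    by (simp add: algebra_simps)
  ultimately show ?case
    using Suc unfolding a_def b_def by linarith
qed simp

lemma stationary_process_expectation:
  fixes f :: "'a::topological_space \<Rightarrow> real"
  assumes Z: "stationary_process M Z" and [measurable]: "f \<in> borel_measurable borel"
  shows "(\<integral>\<omega>. f (Z t \<omega>) \<partial>M) = (\<integral>\<omega>. f (Z 0 \<omega>) \<partial>M)"
proof -
  have [measurable]: "Z t \<in> borel_measurable M" for t
    using Z by (simp add: stationary_process_def)
  have "(\<integral>\<omega>. f (Z h \<omega>) \<partial>M) = (\<integral>x. f (x 0) \<partial>process_law M (\<lambda>t. Z (t + h)))" for h
    unfolding process_law_def by (subst integral_distr) (auto intro!: measurable_PiM_single')
  then show ?thesis
    using Z by (metis (no_types) stationary_process_def add.right_neutral)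
qed

text \<open>
  The empirical measure is the image of a point measure on the finitely many sample times.
\<close>

lemma integral_emp_measure:
  fixes f :: "'a::topological_space \<Rightarrow> real"
  assumes [measurable]: "f \<in> borel_measurable borel"
  shows "(\<integral>x. f x \<partial>emp_measure X n u \<omega>) = (\<Sum>s<nat \<lfloor>u * real n\<rfloor>. f (X (int s + 1) n \<omega>)) / real n"
proof -
  let ?I = "{1..\<lfloor>u * real n\<rfloor>}"
  let ?P = "point_measure ?I (\<lambda>_. ennreal (1 / real n))"
  have [measurable]: "(\<lambda>t. X t n \<omega>) \<in> measurable ?P borel"
    by (simp add: measurable_def space_point_measure sets_point_measure)
  have "emp_measure X n u \<omega> = distr ?P borel (\<lambda>t. X t n \<omega>)"
  proof (rule measure_eqI)
    fix A assume "A \<in> sets (emp_measure X n u \<omega>)"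
    then have A [measurable]: "A \<in> sets borel" by (simp add: sets_emp_measure)
    have "emeasure (distr ?P borel (\<lambda>t. X t n \<omega>)) A =
        emeasure ?P {t \<in> ?I. X t n \<omega> \<in> A}"
      by (subst emeasure_distr) (auto simp: space_point_measure intro!: arg_cong[of _ _ "emeasure ?P"])
    also have "\<dots> = (\<Sum>t\<in>{t \<in> ?I. X t n \<omega> \<in> A}. ennreal (1 / real n))"
      by (rule emeasure_point_measure_finite) auto
    also have "\<dots> = (\<Sum>t\<in>?I. ennreal (1 / real n) * indicator A (X t n \<omega>))"
      by (rule sum.mono_neutral_cong_left) (auto simp: indicator_def)
    also have "\<dots> = emeasure (emp_measure X n u \<omega>) A"
      by (simp add: emeasure_emp_measure sum_distrib_left emeasure_return)
    finally show "emeasure (emp_measure X n u \<omega>) A = emeasure (distr ?P borel (\<lambda>t. X t n \<omega>)) A"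
      by simp
  qed (simp add: sets_emp_measure)
  then have "(\<integral>x. f x \<partial>emp_measure X n u \<omega>) = (\<integral>t. f (X t n \<omega>) \<partial>?P)"
    by (simp add: integral_distr)
  also have "\<dots> = (\<Sum>t\<in>?I. f (X t n \<omega>)) / real n"
    by (subst lebesgue_integral_point_measure_finite[where f = "\<lambda>_. 1 / real n"])
       (auto simp: sum_divide_distrib)
  also have "(\<Sum>t\<in>?I. f (X t n \<omega>)) = (\<Sum>s<nat \<lfloor>u * real n\<rfloor>. f (X (int s + 1) n \<omega>))"
    by (rule sum.reindex_bij_witness[of _ "\<lambda>s. int s + 1" "\<lambda>t. nat (t - 1)"]) (auto, linarith)
  finally show ?thesis .
qed

section \<open>Marginal laws of the auxiliary process and the limit measure\<close>

text \<open>
  Both mean distance conditions are given the same constant, which is moreover nonnegative, so that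
  error terms can be added and enlarged.
\<close>

locale locally_stationary_array = prob_space M
  for M :: "'w measure" +
  fixes X :: "int \<Rightarrow> nat \<Rightarrow> 'w \<Rightarrow> 'a::polish_space"
    and Y :: "int \<Rightarrow> real \<Rightarrow> 'w \<Rightarrow> 'a"
    and C :: real
  assumes C: "C \<ge> 0"
    and X_measurable: "\<And>n t. n \<ge> 1 \<Longrightarrow> X t n \<in> borel_measurable M"
    and Y_stationary: "\<And>u. u \<in> {0..1} \<Longrightarrow> stationary_process M (\<lambda>t. Y t u)"
    and Y_ergodic: "\<And>u. u \<in> {0..1} \<Longrightarrow> ergodic_process M (\<lambda>t. Y t u)"
    and X_close: "\<And>n t. n \<ge> 1 \<Longrightarrow> t \<in> {1..int n} \<Longrightarrow>
      (\<integral>\<omega>. min (dist (X t n \<omega>) (Y t (real_of_int t / real n) \<omega>)) 1 \<partial>M) \<le> C * (1 / real n)"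
    and Y_close: "\<And>t u v. t \<ge> 1 \<Longrightarrow> u \<in> {0..1} \<Longrightarrow> v \<in> {0..1} \<Longrightarrow>
      (\<integral>\<omega>. min (dist (Y t u \<omega>) (Y t v \<omega>)) 1 \<partial>M) \<le> C * \<bar>u - v\<bar>"
begin

lemma Y_measurable: "u \<in> {0..1} \<Longrightarrow> Y t u \<in> borel_measurable M"
  using Y_stationary[of u] by (simp add: stationary_process_def)

lemma integrable_min_dist:
  assumes [measurable]: "U \<in> borel_measurable M" "W \<in> borel_measurable M"
  shows "integrable M (\<lambda>\<omega>. min (dist (U \<omega>) (W \<omega> :: 'a)) 1)"
  by (rule integrable_const_bound[where B = 1]) (auto simp: min_def)

text \<open>
  The mean distance condition is available at times \<open>t \<ge> 1\<close> only, while the limit measure involves time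
  0; stationarity identifies the marginal laws at times 0 and 1.
\<close>

lemma expectation_lipschitz:
  assumes f: "f \<in> borel_measurable borel" "\<And>x. \<bar>f x\<bar> \<le> b"
    and lip: "\<And>x y. \<bar>f x - f y\<bar> \<le> L * min (dist x y) 1"
    and L: "L \<ge> 0" and uv: "u \<in> {0..1}" "v \<in> {0..1}"
  shows "\<bar>(\<integral>\<omega>. f (Y 0 u \<omega>) \<partial>M) - (\<integral>\<omega>. f (Y 0 v \<omega>) \<partial>M)\<bar> \<le> L * (C * \<bar>u - v\<bar>)"
proof -
  note int = bounded_measurable_compose_integrable[OF prob_space_axioms Y_measurable f]
  have "(\<integral>\<omega>. f (Y 0 w \<omega>) \<partial>M) = (\<integral>\<omega>. f (Y 1 w \<omega>) \<partial>M)" if "w \<in> {0..1}" for w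
    using stationary_process_expectation[OF Y_stationary[OF that] f(1), of 1] by simp
  then have "\<bar>(\<integral>\<omega>. f (Y 0 u \<omega>) \<partial>M) - (\<integral>\<omega>. f (Y 0 v \<omega>) \<partial>M)\<bar> =
      \<bar>\<integral>\<omega>. f (Y 1 u \<omega>) - f (Y 1 v \<omega>) \<partial>M\<bar>"
    using uv by (simp add: int)
  also have "\<dots> \<le> (\<integral>\<omega>. \<bar>f (Y 1 u \<omega>) - f (Y 1 v \<omega>)\<bar> \<partial>M)"
    by (rule integral_abs_bound)
  also have "\<dots> \<le> (\<integral>\<omega>. L * min (dist (Y 1 u \<omega>) (Y 1 v \<omega>)) 1 \<partial>M)"
    using uv by (intro integral_mono lip integrable_mult_right integrable_min_dist integrable_abs
        Bochner_Integration.integrable_diff int Y_measurable) auto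
  also have "\<dots> \<le> L * (C * \<bar>u - v\<bar>)"
    using uv L Y_close[of 1 u v] by (simp add: mult_left_mono)
  finally show ?thesis .
qed

definition law :: "real \<Rightarrow> 'a measure" where
  "law \<eta> = distr M borel (Y 0 \<eta>)"

lemma prob_space_law: "\<eta> \<in> {0..1} \<Longrightarrow> prob_space (law \<eta>)"
  unfolding law_def by (rule prob_space_distr) (rule Y_measurable)

lemma sets_law [simp]: "sets (law \<eta>) = sets borel"
  by (simp add: law_def)

lemma integral_law:
  fixes f :: "'a \<Rightarrow> real"
  assumes "\<eta> \<in> {0..1}" "f \<in> borel_measurable borel"
  shows "(\<integral>x. f x \<partial>law \<eta>) = (\<integral>\<omega>. f (Y 0 \<eta> \<omega>) \<partial>M)"
  unfolding law_def using assms Y_measurable by (intro integral_distr) auto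

lemma expectation_continuous:
  assumes "f \<in> borel_measurable borel" "\<And>x. \<bar>f x\<bar> \<le> b"
    and "\<And>x y. \<bar>f x - f y\<bar> \<le> L * min (dist x y) 1" and "L \<ge> 0"
  shows "continuous_on {0..1} (\<lambda>\<eta>. \<integral>\<omega>. f (Y 0 \<eta> \<omega>) \<partial>M)"
proof (rule lipschitz_on_continuous_on)
  show "(L * C)-lipschitz_on {0..1} (\<lambda>\<eta>. \<integral>\<omega>. f (Y 0 \<eta> \<omega>) \<partial>M)"
    using expectation_lipschitz[OF assms] C \<open>L \<ge> 0\<close>
    by (intro lipschitz_onI) (auto simp: dist_real_def mult.assoc)
qed

text \<open>
  Integrals of Lipschitz functions are continuous in \<open>\<eta>\<close>. The functions \<open>max 0 (1 - k * infdist x A)\<close> decrease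
  to the indicator of a closed set \<open>A\<close>, so the probability of \<open>A\<close> is measurable in \<open>\<eta>\<close>, and the closed sets
  form an intersection-stable generator of the Borel sets.
\<close>

lemma law_kernel:
  assumes u: "u \<in> {0..1}"
  shows "law \<in> measurable (restrict_space lborel {0..u}) (subprob_algebra borel)"
proof (rule measurable_subprob_algebra_generated[where G = "Collect closed" and \<Omega> = UNIV])
  show "sets borel = sigma_sets UNIV (Collect closed :: 'a set set)"
    by (simp add: borel_eq_closed)
  show "Int_stable (Collect closed :: 'a set set)"
    by (auto simp: Int_stable_def)
  have sp: "\<eta> \<in> {0..1}" if "\<eta> \<in> space (restrict_space lborel {0..u})" for \<eta>
    using that u by (auto simp: space_restrict_space)
  show "subprob_space (law \<eta>)" if "\<eta> \<in> space (restrict_space lborel {0..u})" for \<eta>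
    using prob_space_law[OF sp[OF that]] by (rule prob_space_imp_subprob_space)
  have closed: "(\<lambda>\<eta>. emeasure (law \<eta>) A) \<in> borel_measurable (restrict_space lborel {0..u})"
    if A: "closed A" "A \<noteq> {}" for A
  proof -
    define g where "g k x = max 0 (1 - real k * infdist x A)" for k :: nat and x
    have g_cont: "continuous_on UNIV (g k)" for k
      unfolding g_def by (intro continuous_intros)
    have g_meas [measurable]: "g k \<in> borel_measurable borel" for k
      by (rule borel_measurable_continuous_onI[OF g_cont])
    have g_bound: "\<bar>g k x\<bar> \<le> 1" for k x
      by (auto simp: g_def infdist_nonneg)
    have g_lip: "\<bar>g k x - g k y\<bar> \<le> max 1 (real k) * min (dist x y) 1" for k x y
    proof -
      have "\<bar>g k x - g k y\<bar> \<le> \<bar>real k * (infdist x A - infdist y A)\<bar>"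
        by (auto simp: g_def algebra_simps)
      also have "\<dots> \<le> real k * dist x y"
        unfolding abs_mult using infdist_triangle_abs[of x A y] by (simp add: mult_left_mono)
      also have "\<dots> \<le> max 1 (real k) * dist x y"
        by (intro mult_right_mono) auto
      finally have "\<bar>g k x - g k y\<bar> \<le> max 1 (real k) * dist x y" .
      moreover have "0 \<le> g k z \<and> g k z \<le> 1" for z
        by (auto simp: g_def infdist_nonneg)
      then have "\<bar>g k x - g k y\<bar> \<le> 1"
        by (smt (verit))
      ultimately show ?thesis
        by (auto simp: min_def)
    qed
    have "(\<lambda>\<eta>. measure (law \<eta>) A) \<in> borel_measurable (restrict_space lborel {0..u})"
    proof (rule borel_measurable_LIMSEQ_real)
      show "(\<lambda>\<eta>. \<integral>\<omega>. g k (Y 0 \<eta> \<omega>) \<partial>M) \<in> borel_measurable (restrict_space lborel {0..u})" for k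
      proof -
        have "continuous_on {0..u} (\<lambda>\<eta>. \<integral>\<omega>. g k (Y 0 \<eta> \<omega>) \<partial>M)"
          using u by (intro continuous_on_subset[OF expectation_continuous[OF g_meas g_bound g_lip]]) auto
        then show ?thesis
          using borel_measurable_continuous_on_restrict
          by (simp add: measurable_cong_sets[OF sets_restrict_space_cong[OF sets_lborel] refl])
      qed
    next
      fix \<eta> assume \<eta>: "\<eta> \<in> space (restrict_space lborel {0..u})"
      interpret nu: prob_space "law \<eta>" by (rule prob_space_law[OF sp[OF \<eta>]])
      have "(\<lambda>k. \<integral>x. g k x \<partial>law \<eta>) \<longlonglongrightarrow> (\<integral>x. indicator A x \<partial>law \<eta>)"
      proof (rule integral_dominated_convergence[where w = "\<lambda>_. 1"])
        show "AE x in law \<eta>. (\<lambda>k. g k x) \<longlonglongrightarrow> indicator A x"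
        proof (rule AE_I2)
          fix x
          show "(\<lambda>k. g k x) \<longlonglongrightarrow> indicator A x"
          proof (cases "x \<in> A")
            case False
            then have d: "infdist x A > 0"
              using A infdist_pos_not_in_closed by blast
            obtain N where N: "real N > 1 / infdist x A"
              using reals_Archimedean2 by blast
            have "g k x = 0" if "k \<ge> N" for k
            proof -
              have "1 / infdist x A < real k" using N that by linarith
              then show ?thesis using d by (simp add: g_def field_simps)
            qed
            then show ?thesis
              using False by (intro tendsto_eventually) (auto simp: eventually_sequentially)
          qed (simp add: g_def)
        qed
      qed (use A g_bound in \<open>auto simp: borel_closed measurable_cong_sets[OF sets_law refl]\<close>)
      then show "(\<lambda>k. \<integral>\<omega>. g k (Y 0 \<eta> \<omega>) \<partial>M) \<longlonglongrightarrow> measure (law \<eta>) A"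
        using A by (simp add: integral_law[OF sp[OF \<eta>] g_meas] borel_closed)
    qed
    then have "(\<lambda>\<eta>. ennreal (measure (law \<eta>) A)) \<in> borel_measurable (restrict_space lborel {0..u})"
      by measurable
    also have "?this \<longleftrightarrow> ?thesis"
    proof (rule measurable_cong)
      fix \<eta> assume "\<eta> \<in> space (restrict_space lborel {0..u})"
      then interpret nu: prob_space "law \<eta>" by (intro prob_space_law sp)
      show "ennreal (measure (law \<eta>) A) = emeasure (law \<eta>) A"
        by (simp add: nu.emeasure_eq_measure)
    qed
    finally show ?thesis .
  qed
  then show "(\<lambda>\<eta>. emeasure (law \<eta>) A) \<in> borel_measurable (restrict_space lborel {0..u})"
    if "A \<in> Collect closed" for A
    using that by (cases "A = {}") auto
  show "(\<lambda>\<eta>. emeasure (law \<eta>) UNIV) \<in> borel_measurable (restrict_space lborel {0..u})"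
    by (rule closed) auto
qed auto

text \<open>
  Writing the mixture of the laws as a monadic bind makes its integration formula available.
\<close>

lemma limit_measure_eq_bind:
  assumes u: "u \<in> {0..1}"
  shows "limit_measure M Y u = restrict_space lborel {0..u} \<bind> law"
proof (rule measure_eqI)
  have ne: "space (restrict_space lborel {0..u}) \<noteq> {}"
    using u by (simp add: space_restrict_space)
  show "sets (limit_measure M Y u) = sets (restrict_space lborel {0..u} \<bind> law)"
    using ne by (simp add: sets_limit_measure)
  have law: "emeasure M {\<omega> \<in> space M. Y 0 \<eta> \<omega> \<in> B} = emeasure (law \<eta>) B"
    if "\<eta> \<in> {0..u}" "B \<in> sets borel" for \<eta> B
    unfolding law_def using that u Y_measurable[of \<eta> 0]
    by (subst emeasure_distr) (auto intro!: arg_cong[of _ _ "emeasure M"])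
  have law_ind: "emeasure M {\<omega> \<in> space M. Y 0 \<eta> \<omega> \<in> B} * indicator {0..u} \<eta> =
      emeasure (law \<eta>) B * indicator {0..u} \<eta>" if "B \<in> sets borel" for \<eta> B
    using law[of \<eta> B] that by (auto split: split_indicator)
  fix A assume "A \<in> sets (limit_measure M Y u)"
  then have A: "A \<in> sets borel" by (simp add: sets_limit_measure)
  have "emeasure (limit_measure M Y u) A =
      (\<integral>\<^sup>+\<eta>\<in>{0..u}. emeasure M {\<omega> \<in> space M. Y 0 \<eta> \<omega> \<in> A} \<partial>lborel)"
  proof (rule emeasure_limit_measure[OF A])
    show "Y 0 \<eta> \<in> borel_measurable M" if "\<eta> \<in> {0..u}" for \<eta>
      using that u by (intro Y_measurable) auto
    fix B :: "'a set" assume B: "B \<in> sets borel"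
    have "(\<lambda>\<eta>. emeasure (law \<eta>) B) \<in> borel_measurable (restrict_space lborel {0..u})"
      by (rule measurable_compose[OF law_kernel[OF u] measurable_emeasure_subprob_algebra[OF B]])
    then show "(\<lambda>\<eta>. emeasure M {\<omega> \<in> space M. Y 0 \<eta> \<omega> \<in> B} * indicator {0..u} \<eta>) \<in> borel_measurable lborel"
      unfolding law_ind[OF B] by (subst (asm) borel_measurable_restrict_space_iff_ennreal) auto
  qed
  also have "\<dots> = (\<integral>\<^sup>+\<eta>. emeasure (law \<eta>) A \<partial>restrict_space lborel {0..u})"
    unfolding law_ind[OF A] by (subst nn_integral_restrict_space) auto
  also have "\<dots> = emeasure (restrict_space lborel {0..u} \<bind> law) A"
    by (rule emeasure_bind[OF ne law_kernel[OF u] A, symmetric])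
  finally show "emeasure (limit_measure M Y u) A = emeasure (restrict_space lborel {0..u} \<bind> law) A" .
qed

lemma expectation_BL_lipschitz:
  assumes f: "BL_norm f \<le> 1" and "u \<in> {0..1}" "v \<in> {0..1}"
  shows "\<bar>(\<integral>\<omega>. f (Y 0 u \<omega>) \<partial>M) - (\<integral>\<omega>. f (Y 0 v \<omega>) \<partial>M)\<bar> \<le> 2 * C * \<bar>u - v\<bar>"
  using expectation_lipschitz[OF BL_measurable[OF f] BL_norm_le_1D(1)[OF f] BL_min_dist[OF f] _ assms(2,3)]
  by simp

lemma expectation_BL_continuous:
  assumes f: "BL_norm f \<le> 1"
  shows "continuous_on {0..1} (\<lambda>\<eta>. \<integral>\<omega>. f (Y 0 \<eta> \<omega>) \<partial>M)"
  by (rule expectation_continuous[OF BL_measurable[OF f] BL_norm_le_1D(1)[OF f] BL_min_dist[OF f]]) simp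

lemma expectation_BL_bound:
  assumes f: "BL_norm f \<le> 1" and u: "u \<in> {0..1}"
  shows "\<bar>\<integral>\<omega>. f (Y 0 u \<omega>) \<partial>M\<bar> \<le> 1"
proof -
  have "\<bar>\<integral>\<omega>. f (Y 0 u \<omega>) \<partial>M\<bar> \<le> (\<integral>\<omega>. \<bar>f (Y 0 u \<omega>)\<bar> \<partial>M)"
    by (rule integral_abs_bound)
  also have "\<dots> \<le> (\<integral>\<omega>. 1 \<partial>M)"
    by (intro integral_mono integrable_abs BL_norm_le_1D(1)[OF f]
        bounded_measurable_compose_integrable[OF prob_space_axioms Y_measurable[OF u] BL_measurable[OF f]
          BL_norm_le_1D(1)[OF f]]) auto
  finally show ?thesis by (simp add: prob_space)
qed

lemma integral_limit_measure:
  assumes f: "BL_norm f \<le> 1" and u: "u \<in> {0..1}"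
  shows "(\<integral>x. f x \<partial>limit_measure M Y u) = integral {0..u} (\<lambda>\<eta>. \<integral>\<omega>. f (Y 0 \<eta> \<omega>) \<partial>M)"
proof -
  have "(\<integral>x. f x \<partial>limit_measure M Y u) = (\<integral>\<eta>. (\<integral>x. f x \<partial>law \<eta>) \<partial>restrict_space lborel {0..u})"
    unfolding limit_measure_eq_bind[OF u]
  proof (rule integral_bind[OF BL_measurable[OF f] _ law_kernel[OF u], where B = 1 and B' = 1])
    show "finite_measure (restrict_space lborel {0..u})"
      using u by (intro finite_measureI) (simp add: emeasure_restrict_space space_restrict_space)
    show "AE \<eta> in restrict_space lborel {0..u}. emeasure (law \<eta>) (space (law \<eta>)) \<le> ennreal 1"
    proof (rule AE_I2)
      fix \<eta> assume "\<eta> \<in> space (restrict_space lborel {0..u})"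
      then have "prob_space (law \<eta>)"
        using u by (intro prob_space_law) (auto simp: space_restrict_space)
      then show "emeasure (law \<eta>) (space (law \<eta>)) \<le> ennreal 1"
        by (simp add: prob_space.emeasure_space_1)
    qed
  qed (rule BL_norm_le_1D(1)[OF f])
  also have "\<dots> = (LINT \<eta>:{0..u}|lborel. (\<integral>x. f x \<partial>law \<eta>))"
    unfolding set_lebesgue_integral_def by (rule integral_restrict_space) simp
  also have "\<dots> = (LINT \<eta>:{0..u}|lborel. (\<integral>\<omega>. f (Y 0 \<eta> \<omega>) \<partial>M))"
    using u by (intro set_lebesgue_integral_cong) (auto intro!: integral_law BL_measurable[OF f])
  also have "\<dots> = integral {0..u} (\<lambda>\<eta>. \<integral>\<omega>. f (Y 0 \<eta> \<omega>) \<partial>M)"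
    using u by (intro set_borel_integral_eq_integral borel_integrable_atLeastAtMost'
        continuous_on_subset[OF expectation_BL_continuous[OF f]]) auto
  finally show ?thesis .
qed

lemma integral_expectation_bound:
  assumes f: "BL_norm f \<le> 1" and uv: "0 \<le> u" "u \<le> v" "v \<le> 1"
  shows "\<bar>integral {0..v} (\<lambda>\<eta>. \<integral>\<omega>. f (Y 0 \<eta> \<omega>) \<partial>M) - integral {0..u} (\<lambda>\<eta>. \<integral>\<omega>. f (Y 0 \<eta> \<omega>) \<partial>M)\<bar> \<le> v - u"
proof -
  let ?\<phi> = "\<lambda>\<eta>. \<integral>\<omega>. f (Y 0 \<eta> \<omega>) \<partial>M"
  have "integral {0..v} ?\<phi> = integral {0..u} ?\<phi> + integral {u..v} ?\<phi>"
    using uv by (intro Henstock_Kurzweil_Integration.integral_combine[symmetric] integrable_continuous_interval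
        continuous_on_subset[OF expectation_BL_continuous[OF f]]) auto
  moreover have "norm (integral {u..v} ?\<phi>) \<le> 1 * (v - u)"
    using uv expectation_BL_bound[OF f]
    by (intro integral_bound continuous_on_subset[OF expectation_BL_continuous[OF f]]) auto
  ultimately show ?thesis by simp
qed

lemma abs_integral_limit_measure_le:
  assumes f: "BL_norm f \<le> 1" and u: "u \<in> {0..1}"
  shows "\<bar>\<integral>x. f x \<partial>limit_measure M Y u\<bar> \<le> 1"
  using integral_expectation_bound[OF f, of 0 u] u by (simp add: integral_limit_measure[OF f])

end

section \<open>Grid points and blocks\<close>

lemma mono_sublevel_lessThan:
  fixes q :: "nat \<Rightarrow> nat"
  assumes "mono q"
  shows "\<exists>b\<le>k. {s. s < k \<and> q s < j} = {..<b}"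
proof (induction k)
  case (Suc k)
  show ?case
  proof (cases "q k < j")
    case True
    then have "q s < j" if "s \<le> k" for s
      using monoD[OF assms that] by simp
    then have "{s. s < Suc k \<and> q s < j} = {..<Suc k}" by auto
    then show ?thesis by blast
  next
    case False
    then have "{s. s < Suc k \<and> q s < j} = {s. s < k \<and> q s < j}"
      by (auto simp: less_Suc_eq)
    then show ?thesis using Suc by (metis le_SucI)
  qed
qed simp

text \<open>
  For each \<open>j\<close> the indices with \<open>q s = j\<close> form an interval, so a block sum is the difference of two
  initial segments, each at most \<open>B j\<close>.
\<close>

lemma abs_sum_blocks_le:
  fixes F :: "nat \<Rightarrow> nat \<Rightarrow> real"
  assumes q: "mono q" "\<And>s. s < k \<Longrightarrow> q s < m"
    and B: "\<And>j k'. j < m \<Longrightarrow> k' \<le> k \<Longrightarrow> \<bar>\<Sum>s<k'. F j s\<bar> \<le> B j"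
  shows "\<bar>\<Sum>s<k. F (q s) s\<bar> \<le> (\<Sum>j<m. 2 * B j)"
proof -
  have "(\<Sum>s<k. F (q s) s) = (\<Sum>j<m. \<Sum>s\<in>{s\<in>{..<k}. q s = j}. F (q s) s)"
    using q(2) by (intro sum.group[symmetric]) auto
  also have "\<dots> = (\<Sum>j<m. \<Sum>s\<in>{s\<in>{..<k}. q s = j}. F j s)"
    by (intro sum.cong) auto
  also have "\<bar>\<dots>\<bar> \<le> (\<Sum>j<m. 2 * B j)"
  proof (rule order_trans[OF sum_abs], rule sum_mono)
    fix j assume "j \<in> {..<m}"
    then have j: "j < m" by simp
    obtain b where b: "b \<le> k" "{s. s < k \<and> q s < j} = {..<b}"
      using mono_sublevel_lessThan[OF q(1)] by blast
    obtain c where c: "c \<le> k" "{s. s < k \<and> q s < Suc j} = {..<c}"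
      using mono_sublevel_lessThan[OF q(1)] by blast
    have "{..<b} \<subseteq> {..<c}"
      unfolding b(2)[symmetric] c(2)[symmetric] by auto
    moreover have "{s \<in> {..<k}. q s = j} = {..<c} - {..<b}"
      unfolding b(2)[symmetric] c(2)[symmetric] by auto
    ultimately have "(\<Sum>s\<in>{s\<in>{..<k}. q s = j}. F j s) = (\<Sum>s<c. F j s) - (\<Sum>s<b. F j s)"
      by (simp only: sum_diff[OF finite_lessThan])
    then show "\<bar>\<Sum>s\<in>{s\<in>{..<k}. q s = j}. F j s\<bar> \<le> 2 * B j"
      using B[OF j b(1)] B[OF j c(1)] by linarith
  qed
  finally show ?thesis .
qed

lemma floor_sample_bounds:
  assumes "u \<in> {0..1}" "n \<ge> 1"
  defines "k \<equiv> nat \<lfloor>u * real n\<rfloor>"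
  shows "k \<le> n" "real k / real n \<le> u" "u - real k / real n \<le> 1 / real n"
proof -
  have k: "real k = of_int \<lfloor>u * real n\<rfloor>"
    using assms by (simp add: k_def)
  have le: "real k \<le> u * real n" "u * real n \<le> real k + 1"
    unfolding k by linarith+
  have "u * real n \<le> 1 * real n"
    using assms by (intro mult_right_mono) auto
  then show "k \<le> n"
    using le by linarith
  show "real k / real n \<le> u"
    using le assms(2) by (simp add: pos_divide_le_eq)
  have "u - real k / real n = (u * real n - real k) / real n"
    using assms(2) by (simp add: diff_divide_distrib)
  also have "\<dots> \<le> 1 / real n"
    using le by (intro divide_right_mono) auto
  finally show "u - real k / real n \<le> 1 / real n" .
qed

text \<open>
  The grid point \<open>g\<close> is the rescaled time \<open>s / n\<close> rounded down to a multiple of \<open>1 / m\<close>; sample times are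
  \<open>s + 1\<close>, which adds \<open>1 / n\<close> to the rounding error.
\<close>

lemma grid_point_bounds:
  fixes m n s :: nat
  assumes m: "m \<ge> 1" and n: "n \<ge> 1" and s: "s < n"
  defines "p \<equiv> real (s + 1) / real n" and "g \<equiv> real (s * m div n) / real m"
  shows "s * m div n < m" "p \<in> {0..1}" "g \<in> {0..1}" "\<bar>p - g\<bar> \<le> 1 / real m + 1 / real n"
proof -
  have n0: "real n > 0" and m0: "real m > 0" using n m by auto
  have sm: "s * m < m * n" using s m by simp
  show q: "s * m div n < m"
    using sm n by (simp add: div_less_iff_less_mult)
  have "real (s * m) = real (s * m div n) * real n + real (s * m mod n)"
    by (metis div_mult_mod_eq of_nat_add of_nat_mult)
  moreover have "0 \<le> real (s * m mod n)" "real (s * m mod n) \<le> real n"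
    using n by (auto intro: less_imp_le)
  ultimately have "real (s * m div n) * real n \<le> real s * real m"
    "real s * real m \<le> real (s * m div n) * real n + real n"
    unfolding of_nat_mult[of s m, symmetric] by linarith+
  then have "g \<le> real s / real n" "real s / real n \<le> g + 1 / real m"
    using n0 m0 by (simp_all add: g_def field_simps)
  moreover have "p = real s / real n + 1 / real n"
    by (simp add: p_def add_divide_distrib add.commute)
  moreover have "1 / real n > 0" "1 / real m > 0"
    using n0 m0 by auto
  ultimately show "\<bar>p - g\<bar> \<le> 1 / real m + 1 / real n"
    by linarith
  show "p \<in> {0..1}" using s by (simp add: p_def)
  show "g \<in> {0..1}" using q by (simp add: g_def)
qed

context locally_stationary_array begin

section \<open>The supremum over parameters and test functions\<close>

text \<open>
  These two rules characterise the double supremum, whose members are all bounded by 2. The array \<open>X'\<close>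
  is arbitrary, so that they also apply to the coordinates on path space.
\<close>

lemma d_BL_emp_limit:
  fixes X' :: "int \<Rightarrow> nat \<Rightarrow> 'v \<Rightarrow> 'a"
  defines "S n x \<equiv> SUP u\<in>{0..1}. d_BL (emp_measure X' n u x) (limit_measure M Y u)"
  shows sup_d_BL_upper: "u \<in> {0..1} \<Longrightarrow> BL_norm f \<le> 1 \<Longrightarrow>
      \<bar>(\<integral>y. f y \<partial>emp_measure X' n u x) - (\<integral>y. f y \<partial>limit_measure M Y u)\<bar> \<le> S n x"
    and sup_d_BL_least: "(\<And>u f. u \<in> {0..1} \<Longrightarrow> BL_norm f \<le> 1 \<Longrightarrow>
      \<bar>(\<integral>y. f y \<partial>emp_measure X' n u x) - (\<integral>y. f y \<partial>limit_measure M Y u)\<bar> \<le> c) \<Longrightarrow> S n x \<le> c"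
proof -
  have emp: "\<bar>\<integral>y. f y \<partial>emp_measure X' n u x\<bar> \<le> 1" if f: "BL_norm f \<le> 1" and u: "u \<in> {0..1}" for f u
  proof (cases "n = 0")
    case False
    then have n: "n \<ge> 1" by simp
    have "\<bar>\<Sum>s<nat \<lfloor>u * real n\<rfloor>. f (X' (int s + 1) n x)\<bar> \<le> (\<Sum>s<nat \<lfloor>u * real n\<rfloor>. 1)"
      by (intro order_trans[OF sum_abs] sum_mono BL_norm_le_1D(1)[OF f])
    also have "\<dots> \<le> real n"
      using floor_sample_bounds(1)[OF u n] by simp
    finally show ?thesis
      using n by (simp add: integral_emp_measure[OF BL_measurable[OF f]])
  qed (simp add: integral_emp_measure[OF BL_measurable[OF f]])
  have gap: "\<bar>(\<integral>y. f y \<partial>emp_measure X' n u x) - (\<integral>y. f y \<partial>limit_measure M Y u)\<bar> \<le> 2"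
    if "BL_norm f \<le> 1" "u \<in> {0..1}" for f u
    using emp[OF that] abs_integral_limit_measure_le[OF that] by linarith
  have bdd: "bdd_above ((\<lambda>f. \<bar>(\<integral>y. f y \<partial>emp_measure X' n u x) - (\<integral>y. f y \<partial>limit_measure M Y u)\<bar>) ` {f. BL_norm f \<le> 1})"
    if "u \<in> {0..1}" for u
    using gap that by (intro bdd_aboveI2[of _ _ 2]) auto
  have ne: "{f :: 'a \<Rightarrow> real. BL_norm f \<le> 1} \<noteq> {}"
    using BL_norm_zero by blast
  have "d_BL (emp_measure X' n u x) (limit_measure M Y u) \<le> 2" if "u \<in> {0..1}" for u
    unfolding d_BL_def using gap that by (intro cSUP_least[OF ne]) auto
  then have bdd': "bdd_above ((\<lambda>u. d_BL (emp_measure X' n u x) (limit_measure M Y u)) ` {0..1})"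
    by (intro bdd_aboveI2)
  show "\<bar>(\<integral>y. f y \<partial>emp_measure X' n u x) - (\<integral>y. f y \<partial>limit_measure M Y u)\<bar> \<le> S n x"
    if u: "u \<in> {0..1}" and f: "BL_norm f \<le> 1"
  proof -
    have "\<bar>(\<integral>y. f y \<partial>emp_measure X' n u x) - (\<integral>y. f y \<partial>limit_measure M Y u)\<bar> \<le>
        d_BL (emp_measure X' n u x) (limit_measure M Y u)"
      unfolding d_BL_def using f by (intro cSUP_upper[OF _ bdd[OF u]]) auto
    also have "\<dots> \<le> S n x"
      unfolding S_def by (rule cSUP_upper[OF u bdd'])
    finally show ?thesis .
  qed
  show "S n x \<le> c"
    if "\<And>u f. u \<in> {0..1} \<Longrightarrow> BL_norm f \<le> 1 \<Longrightarrow>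
      \<bar>(\<integral>y. f y \<partial>emp_measure X' n u x) - (\<integral>y. f y \<partial>limit_measure M Y u)\<bar> \<le> c"
    unfolding S_def d_BL_def using that by (intro cSUP_least ne) auto
qed

text \<open>
  The supremum runs over uncountable sets, but as a function \<open>G\<close> of the sample path it is Lipschitz with
  respect to the sum of the distances at the first \<open>n\<close> coordinates. It is thus continuous for the product
  topology, whose Borel sets are the product sets because the space is second countable and the index
  set countable. For \<open>n = 0\<close> the sample is empty and the supremum constant.
\<close>

lemma sup_d_BL_measurable:
  "(\<lambda>\<omega>. SUP u\<in>{0..1}. d_BL (emp_measure X n u \<omega>) (limit_measure M Y u)) \<in> borel_measurable M"
proof (cases "n = 0")
  case True
  then have eq: "emp_measure X n u \<omega> = emp_measure X n u undefined" for u \<omega>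
    by (simp add: emp_measure_def)
  have "(\<lambda>\<omega>. SUP u\<in>{0..1}. d_BL (emp_measure X n u \<omega>) (limit_measure M Y u)) =
      (\<lambda>\<omega>. SUP u\<in>{0..1}. d_BL (emp_measure X n u undefined) (limit_measure M Y u))"
    by (intro ext SUP_cong refl arg_cong2[where f = d_BL] eq)
  then show ?thesis
    by (metis borel_measurable_const)
next
  case False
  then have n: "n \<ge> 1" by simp
  define X' :: "int \<Rightarrow> nat \<Rightarrow> (int \<Rightarrow> 'a) \<Rightarrow> 'a" where "X' t k x = x t" for t k x
  define G where "G x = (SUP u\<in>{0..1}. d_BL (emp_measure X' n u x) (limit_measure M Y u))" for x
  have G_le: "G x \<le> G y + (\<Sum>s<n. dist (x (int s + 1)) (y (int s + 1)))" for x y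
    unfolding G_def
  proof (rule sup_d_BL_least)
    fix u :: real and f :: "'a \<Rightarrow> real"
    assume u: "u \<in> {0..1}" and f: "BL_norm f \<le> 1"
    let ?k = "nat \<lfloor>u * real n\<rfloor>"
    let ?I = "\<lambda>x. \<integral>y. f y \<partial>emp_measure X' n u x"
    have "\<bar>?I x - ?I y\<bar> = \<bar>\<Sum>s<?k. f (x (int s + 1)) - f (y (int s + 1))\<bar> / real n"
      by (simp add: integral_emp_measure[OF BL_measurable[OF f]] X'_def sum_subtractf flip: diff_divide_distrib)
    also have "\<dots> \<le> \<bar>\<Sum>s<?k. f (x (int s + 1)) - f (y (int s + 1))\<bar>"
      using n by (simp add: divide_le_eq mult_le_cancel_left1)
    also have "\<dots> \<le> (\<Sum>s<?k. dist (x (int s + 1)) (y (int s + 1)))"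
      by (intro order_trans[OF sum_abs] sum_mono BL_norm_le_1D(2)[OF f])
    also have "\<dots> \<le> (\<Sum>s<n. dist (x (int s + 1)) (y (int s + 1)))"
      using floor_sample_bounds(1)[OF u n] by (intro sum_mono2) auto
    finally have "\<bar>?I x - ?I y\<bar> \<le> (\<Sum>s<n. dist (x (int s + 1)) (y (int s + 1)))" .
    moreover note sup_d_BL_upper[OF u f, of X' n y]
    ultimately show "\<bar>?I x - (\<integral>y. f y \<partial>limit_measure M Y u)\<bar> \<le>
        (SUP u\<in>{0..1}. d_BL (emp_measure X' n u y) (limit_measure M Y u)) + (\<Sum>s<n. dist (x (int s + 1)) (y (int s + 1)))"
      by linarith
  qed
  have "continuous_on UNIV G"
    unfolding continuous_on_eq_continuous_at[OF open_UNIV] isCont_def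
  proof
    fix x :: "int \<Rightarrow> 'a"
    have "continuous_on UNIV (\<lambda>y. \<Sum>s<n. dist (y (int s + 1)) (x (int s + 1)))"
      by (intro continuous_intros continuous_on_product_coordinates)
    then have "isCont (\<lambda>y. \<Sum>s<n. dist (y (int s + 1)) (x (int s + 1))) x"
      by (simp add: continuous_on_eq_continuous_at)
    then have "((\<lambda>y. \<Sum>s<n. dist (y (int s + 1)) (x (int s + 1))) \<longlongrightarrow> 0) (at x)"
      by (simp add: isCont_def)
    moreover have "norm (G y - G x) \<le> (\<Sum>s<n. dist (y (int s + 1)) (x (int s + 1)))" for y
      using G_le[of x y] G_le[of y x] by (simp add: dist_commute abs_le_iff)
    then have "\<forall>\<^sub>F y in at x. norm (G y - G x) \<le> (\<Sum>s<n. dist (y (int s + 1)) (x (int s + 1)))"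
      by (rule always_eventually[OF allI])
    ultimately have "((\<lambda>y. G y - G x) \<longlongrightarrow> 0) (at x)"
      by (rule Lim_null_comparison[rotated])
    then show "(G \<longlongrightarrow> G x) (at x)"
      by (simp add: LIM_zero_iff)
  qed
  then have "G \<in> borel_measurable borel"
    by (rule borel_measurable_continuous_onI)
  then have G [measurable]: "G \<in> borel_measurable (Pi\<^sub>M UNIV (\<lambda>_. borel))"
    by (simp add: measurable_cong_sets[OF sets_PiM_equal_borel refl])
  have [measurable]: "X t n \<in> borel_measurable M" for t
    using n by (rule X_measurable)
  have "(\<lambda>\<omega> t. X t n \<omega>) \<in> measurable M (Pi\<^sub>M UNIV (\<lambda>_. borel))"
    by (intro measurable_PiM_single') auto
  then have "(\<lambda>\<omega>. G (\<lambda>t. X t n \<omega>)) \<in> borel_measurable M"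
    by measurable
  moreover have "emp_measure X' n u (\<lambda>t. X t n \<omega>) = emp_measure X n u \<omega>" for u \<omega>
    by (simp add: emp_measure_def X'_def)
  ultimately show ?thesis
    by (simp add: G_def)
qed

section \<open>Coupling with finitely many stationary processes\<close>

text \<open>
  The observation at time \<open>s + 1\<close> is replaced by the auxiliary process at the parameter \<open>(s + 1) / n\<close>, and
  that by the auxiliary process at the grid point \<open>g s\<close>, of which only \<open>m\<close> values occur. On each block of
  constant \<open>g\<close> a single stationary process remains, and \<open>V j\<close> bounds its centred sums. The centring
  \<open>\<phi> (g s)\<close> is then moved back to \<open>\<phi> ((s + 1) / n)\<close>, whose average is a Riemann sum of the limit. No
  error term on the right depends on \<open>u\<close> or \<open>f\<close>.
\<close>

lemma grid_coupling_bound: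
  fixes m n :: nat and V :: "nat \<Rightarrow> 'w \<Rightarrow> real"
  assumes m: "m \<ge> 1" and n: "n \<ge> 1"
    and V: "\<And>j k f. j < m \<Longrightarrow> k \<le> n \<Longrightarrow> BL_norm f \<le> 1 \<Longrightarrow>
      \<bar>\<Sum>s<k. f (Y (int s + 1) (real j / real m) \<omega>) - (\<integral>\<omega>. f (Y 0 (real j / real m) \<omega>) \<partial>M)\<bar> \<le> real n * V j \<omega>"
  defines "g s \<equiv> real (s * m div n) / real m"
  shows "(SUP u\<in>{0..1}. d_BL (emp_measure X n u \<omega>) (limit_measure M Y u)) \<le>
    2 * (\<Sum>s<n. min (dist (X (int s + 1) n \<omega>) (Y (int s + 1) (real (s + 1) / real n) \<omega>)) 1) / real n +
    2 * (\<Sum>s<n. min (dist (Y (int s + 1) (real (s + 1) / real n) \<omega>) (Y (int s + 1) (g s) \<omega>)) 1) / real n +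
    (\<Sum>j<m. 2 * V j \<omega>) + 2 * C * (1 / real m + 1 / real n) + (2 * C + 1) / real n"
    (is "_ \<le> 2 * (\<Sum>s<n. ?a s) / _ + 2 * (\<Sum>s<n. ?b s) / _ + _ + _ + _")
proof (rule sup_d_BL_least)
  fix u :: real and f :: "'a \<Rightarrow> real"
  assume u: "u \<in> {0..1}" and f: "BL_norm f \<le> 1"
  define \<phi> where "\<phi> \<eta> = (\<integral>\<omega>. f (Y 0 \<eta> \<omega>) \<partial>M)" for \<eta>
  define k where "k = nat \<lfloor>u * real n\<rfloor>"
  define p where "p s = real (s + 1) / real n" for s
  note k = floor_sample_bounds[OF u n, folded k_def]
  have n0: "real n > 0" and m0: "real m > 0" using n m by auto
  let ?x = "\<lambda>s. f (X (int s + 1) n \<omega>)"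
  let ?y = "\<lambda>s. f (Y (int s + 1) (p s) \<omega>)"
  let ?z = "\<lambda>s. f (Y (int s + 1) (g s) \<omega>)"
  have limit: "\<bar>integral {0..u} \<phi> - (\<Sum>s<k. \<phi> (p s)) / real n\<bar> \<le> (2 * C + 1) / real n"
  proof -
    have "\<bar>integral {0..real k / real n} \<phi> - (\<Sum>s<k. \<phi> (p s)) / real n\<bar> \<le> real k * (2 * C * (1 / real n)\<^sup>2)"
      unfolding p_def \<phi>_def
      using k(1) n C expectation_BL_lipschitz[OF f] expectation_BL_continuous[OF f]
      by (intro riemann_sum_lipschitz) auto
    also have "\<dots> \<le> real n * (2 * C * (1 / real n)\<^sup>2)"
      using k(1) C by (intro mult_right_mono) auto
    also have "\<dots> = 2 * C / real n"
      using n0 by (simp add: power2_eq_square)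
    finally have "\<bar>integral {0..real k / real n} \<phi> - (\<Sum>s<k. \<phi> (p s)) / real n\<bar> \<le> 2 * C / real n" .
    moreover have "\<bar>integral {0..u} \<phi> - integral {0..real k / real n} \<phi>\<bar> \<le> u - real k / real n"
      unfolding \<phi>_def using u k by (intro integral_expectation_bound[OF f]) auto
    ultimately show ?thesis
      using k(3) unfolding add_divide_distrib by linarith
  qed
  have grid: "s * m div n < m" "\<bar>p s - g s\<bar> \<le> 1 / real m + 1 / real n" "p s \<in> {0..1}" "g s \<in> {0..1}"
    if "s < n" for s
    using grid_point_bounds[OF m n that] by (simp_all add: p_def g_def)
  have 1: "\<bar>\<Sum>s<k. ?x s - ?y s\<bar> \<le> 2 * (\<Sum>s<n. ?a s)"
  proof -
    have "\<bar>\<Sum>s<k. ?x s - ?y s\<bar> \<le> (\<Sum>s<k. 2 * ?a s)"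
      unfolding p_def by (intro order_trans[OF sum_abs] sum_mono BL_min_dist[OF f])
    also have "\<dots> \<le> (\<Sum>s<n. 2 * ?a s)"
      using k(1) by (intro sum_mono2) auto
    finally show ?thesis by (simp only: sum_distrib_left)
  qed
  have 2: "\<bar>\<Sum>s<k. ?y s - ?z s\<bar> \<le> 2 * (\<Sum>s<n. ?b s)"
  proof -
    have "\<bar>\<Sum>s<k. ?y s - ?z s\<bar> \<le> (\<Sum>s<k. 2 * ?b s)"
      unfolding p_def by (intro order_trans[OF sum_abs] sum_mono BL_min_dist[OF f])
    also have "\<dots> \<le> (\<Sum>s<n. 2 * ?b s)"
      using k(1) by (intro sum_mono2) auto
    finally show ?thesis by (simp only: sum_distrib_left)
  qed
  have 3: "\<bar>\<Sum>s<k. ?z s - \<phi> (g s)\<bar> \<le> (\<Sum>j<m. 2 * (real n * V j \<omega>))"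
    unfolding g_def
  proof (rule abs_sum_blocks_le[where q = "\<lambda>s. s * m div n" and
        F = "\<lambda>j s. f (Y (int s + 1) (real j / real m) \<omega>) - \<phi> (real j / real m)"])
    show "mono (\<lambda>s. s * m div n)"
      by (intro monoI div_le_mono mult_right_mono) auto
    show "s * m div n < m" if "s < k" for s
      using grid(1)[of s] that k(1) by simp
    show "\<bar>\<Sum>s<k'. f (Y (int s + 1) (real j / real m) \<omega>) - \<phi> (real j / real m)\<bar> \<le> real n * V j \<omega>"
      if "j < m" "k' \<le> k" for j k'
      unfolding \<phi>_def using that k(1) f by (intro V) auto
  qed
  have 4: "\<bar>\<Sum>s<k. \<phi> (g s) - \<phi> (p s)\<bar> \<le> real n * (2 * C * (1 / real m + 1 / real n))"
  proof -
    have "\<bar>\<Sum>s<k. \<phi> (g s) - \<phi> (p s)\<bar> \<le> (\<Sum>s<k. 2 * C * (1 / real m + 1 / real n))"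
    proof (intro order_trans[OF sum_abs] sum_mono)
      fix s assume "s \<in> {..<k}"
      then have s: "s < n" using k(1) by simp
      have "\<bar>\<phi> (g s) - \<phi> (p s)\<bar> \<le> 2 * C * \<bar>g s - p s\<bar>"
        unfolding \<phi>_def using grid[OF s] by (intro expectation_BL_lipschitz[OF f]) auto
      also have "\<dots> \<le> 2 * C * (1 / real m + 1 / real n)"
        using grid(2)[OF s] C by (intro mult_left_mono) (auto simp: abs_minus_commute)
      finally show "\<bar>\<phi> (g s) - \<phi> (p s)\<bar> \<le> 2 * C * (1 / real m + 1 / real n)" .
    qed
    also have "\<dots> = real k * (2 * C * (1 / real m + 1 / real n))"
      by simp
    also have "\<dots> \<le> real n * (2 * C * (1 / real m + 1 / real n))"
      using k(1) C by (intro mult_right_mono) auto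
    finally show ?thesis .
  qed
  have "(\<Sum>s<k. ?x s) - (\<Sum>s<k. \<phi> (p s)) = (\<Sum>s<k. ?x s - ?y s) + (\<Sum>s<k. ?y s - ?z s) +
      (\<Sum>s<k. ?z s - \<phi> (g s)) + (\<Sum>s<k. \<phi> (g s) - \<phi> (p s))"
    by (simp add: sum_subtractf)
  then have "\<bar>(\<Sum>s<k. ?x s) - (\<Sum>s<k. \<phi> (p s))\<bar> \<le> 2 * (\<Sum>s<n. ?a s) + 2 * (\<Sum>s<n. ?b s) +
      (\<Sum>j<m. 2 * (real n * V j \<omega>)) + real n * (2 * C * (1 / real m + 1 / real n))"
    using 1 2 3 4 by linarith
  also have "\<dots> = real n * (2 * (\<Sum>s<n. ?a s) / real n + 2 * (\<Sum>s<n. ?b s) / real n +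
      (\<Sum>j<m. 2 * V j \<omega>) + 2 * C * (1 / real m + 1 / real n))" (is "_ = real n * ?R")
  proof -
    have "(\<Sum>j<m. 2 * (real n * V j \<omega>)) = real n * (\<Sum>j<m. 2 * V j \<omega>)"
      by (simp add: sum_distrib_left mult_ac)
    then show ?thesis using n0 by (simp add: distrib_left)
  qed
  finally have "\<bar>(\<Sum>s<k. ?x s) / real n - (\<Sum>s<k. \<phi> (p s)) / real n\<bar> \<le> ?R"
    using n0 unfolding diff_divide_distrib[symmetric] by (simp add: pos_divide_le_eq mult.commute)
  moreover have "(\<integral>x. f x \<partial>emp_measure X n u \<omega>) = (\<Sum>s<k. ?x s) / real n"
    by (simp add: integral_emp_measure[OF BL_measurable[OF f]] k_def)
  moreover have "(\<integral>x. f x \<partial>limit_measure M Y u) = integral {0..u} \<phi>"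
    unfolding \<phi>_def by (rule integral_limit_measure[OF f u])
  ultimately show "\<bar>(\<integral>x. f x \<partial>emp_measure X n u \<omega>) - (\<integral>x. f x \<partial>limit_measure M Y u)\<bar> \<le>
      ?R + (2 * C + 1) / real n"
    using limit by linarith
qed

text \<open>
  Local stationarity bounds the means of the two coupling terms, and the ergodic theorem makes those of
  the \<open>m\<close> block terms tend to \<open>2 \<epsilon>\<close> each. The grid size \<open>m\<close> is fixed before \<open>\<epsilon>\<close>, so \<open>\<epsilon> = 1 / m\<^sup>2\<close> leaves a
  total of \<open>2 / m\<close> from the blocks, besides \<open>4 C / m\<close> from the discretisation.
\<close>

lemma sup_d_BL_bound_in_mean:
  fixes m :: nat
  assumes m: "m \<ge> 1"
  obtains R :: "nat \<Rightarrow> 'w \<Rightarrow> real" and e :: "nat \<Rightarrow> real"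
  where "\<And>n. n \<ge> 1 \<Longrightarrow> integrable M (R n)"
    "\<And>n \<omega>. n \<ge> 1 \<Longrightarrow> (SUP u\<in>{0..1}. d_BL (emp_measure X n u \<omega>) (limit_measure M Y u)) \<le> R n \<omega>"
    "\<And>n. n \<ge> 1 \<Longrightarrow> (\<integral>\<omega>. R n \<omega> \<partial>M) \<le> e n" "e \<longlonglongrightarrow> (4 * C + 2) / real m"
proof -
  have m0: "real m > 0" using m by simp
  define \<epsilon> where "\<epsilon> = (1 / real m)\<^sup>2"
  have \<epsilon>: "\<epsilon> > 0" using m0 by (simp add: \<epsilon>_def)
  have "\<exists>V :: nat \<Rightarrow> 'w \<Rightarrow> real. (\<forall>n. integrable M (V n)) \<and> (\<lambda>n. \<integral>\<omega>. V n \<omega> \<partial>M) \<longlonglongrightarrow> 0 \<and>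
      (\<forall>n k f \<omega>. n \<ge> 1 \<longrightarrow> k \<le> n \<longrightarrow> BL_norm f \<le> 1 \<longrightarrow>
       \<bar>\<Sum>s<k. f (Y (int s + 1) u \<omega>) - (\<integral>\<omega>. f (Y 0 u \<omega>) \<partial>M)\<bar> \<le> real n * (\<epsilon> + V n \<omega>))"
    if "u \<in> {0..1}" for u
    by (rule ergodic_process_BL_averages[OF prob_space_axioms Y_stationary[OF that] Y_ergodic[OF that] \<epsilon>]) blast
  then obtain W :: "real \<Rightarrow> nat \<Rightarrow> 'w \<Rightarrow> real" where W:
    "\<And>u n. u \<in> {0..1} \<Longrightarrow> integrable M (W u n)"
    "\<And>u. u \<in> {0..1} \<Longrightarrow> (\<lambda>n. \<integral>\<omega>. W u n \<omega> \<partial>M) \<longlonglongrightarrow> 0"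
    "\<And>u n k f \<omega>. u \<in> {0..1} \<Longrightarrow> n \<ge> 1 \<Longrightarrow> k \<le> n \<Longrightarrow> BL_norm f \<le> 1 \<Longrightarrow>
       \<bar>\<Sum>s<k. f (Y (int s + 1) u \<omega>) - (\<integral>\<omega>. f (Y 0 u \<omega>) \<partial>M)\<bar> \<le> real n * (\<epsilon> + W u n \<omega>)"
    by metis
  define V where "V j n \<omega> = \<epsilon> + W (real j / real m) n \<omega>" for j n \<omega>
  have node: "real j / real m \<in> {0..1}" if "j < m" for j
    using that by simp
  define g where "g n s = real (s * m div n) / real m" for n s
  define p where "p n s = real (s + 1) / real n" for n s
  have p01: "p n s \<in> {0..1}" and g01: "g n s \<in> {0..1}" and pg: "\<bar>p n s - g n s\<bar> \<le> 1 / real m + 1 / real n"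
    if "n \<ge> 1" "s < n" for n s
    using grid_point_bounds[OF m that] by (simp_all add: p_def g_def)
  define a where "a n s \<omega> = min (dist (X (int s + 1) n \<omega>) (Y (int s + 1) (p n s) \<omega>)) 1" for n s \<omega>
  define b where "b n s \<omega> = min (dist (Y (int s + 1) (p n s) \<omega>) (Y (int s + 1) (g n s) \<omega>)) 1" for n s \<omega>
  have a: "integrable M (a n s)" "(\<integral>\<omega>. a n s \<omega> \<partial>M) \<le> C * (1 / real n)" if "n \<ge> 1" "s < n" for n s
    using that X_close[of n "int s + 1"] unfolding a_def[abs_def]
    by (auto intro!: integrable_min_dist X_measurable Y_measurable p01 simp: p_def add.commute)
  have b: "integrable M (b n s)" "(\<integral>\<omega>. b n s \<omega> \<partial>M) \<le> C * (1 / real m + 1 / real n)" if "n \<ge> 1" "s < n" for n s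
  proof -
    show "integrable M (b n s)"
      using that unfolding b_def[abs_def] by (intro integrable_min_dist Y_measurable p01 g01) auto
    have "(\<integral>\<omega>. b n s \<omega> \<partial>M) \<le> C * \<bar>p n s - g n s\<bar>"
      unfolding b_def using p01[OF that] g01[OF that] by (intro Y_close) auto
    also have "\<dots> \<le> C * (1 / real m + 1 / real n)"
      using pg[OF that] C by (intro mult_left_mono) auto
    finally show "(\<integral>\<omega>. b n s \<omega> \<partial>M) \<le> C * (1 / real m + 1 / real n)" .
  qed
  have EV: "integrable M (V j n)" "(\<integral>\<omega>. V j n \<omega> \<partial>M) = \<epsilon> + (\<integral>\<omega>. W (real j / real m) n \<omega> \<partial>M)" if "j < m" for j n
    using W(1)[OF node[OF that]] by (simp_all add: V_def[abs_def] prob_space)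
  define K where "K n = 2 * C * (1 / real m + 1 / real n) + (2 * C + 1) / real n" for n
  define R where "R n \<omega> = 2 * (\<Sum>s<n. a n s \<omega>) / real n + 2 * (\<Sum>s<n. b n s \<omega>) / real n +
    (\<Sum>j<m. 2 * V j n \<omega>) + K n" for n \<omega>
  define e where "e n = 2 * C * (1 / real n) + 2 * C * (1 / real m + 1 / real n) +
    (\<Sum>j<m. 2 * (\<epsilon> + (\<integral>\<omega>. W (real j / real m) n \<omega> \<partial>M))) + K n" for n
  show ?thesis
  proof (rule that[of R e])
    fix n :: nat assume n: "n \<ge> 1"
    have int_a: "integrable M (\<lambda>\<omega>. 2 * (\<Sum>s<n. a n s \<omega>) / real n)"
      and int_b: "integrable M (\<lambda>\<omega>. 2 * (\<Sum>s<n. b n s \<omega>) / real n)"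
      and int_V: "integrable M (\<lambda>\<omega>. \<Sum>j<m. 2 * V j n \<omega>)"
      using a(1)[OF n] b(1)[OF n] EV(1)
      by (auto intro!: Bochner_Integration.integrable_sum integrable_mult_right integrable_divide)
    show "integrable M (R n)"
      unfolding R_def[abs_def] using int_a int_b int_V by (intro Bochner_Integration.integrable_add) auto
    show "(SUP u\<in>{0..1}. d_BL (emp_measure X n u \<omega>) (limit_measure M Y u)) \<le> R n \<omega>" for \<omega>
    proof -
      have V_bound: "\<bar>\<Sum>s<k. f (Y (int s + 1) (real j / real m) \<omega>) - (\<integral>\<omega>. f (Y 0 (real j / real m) \<omega>) \<partial>M)\<bar>
          \<le> real n * V j n \<omega>" if "j < m" "k \<le> n" "BL_norm f \<le> 1" for j k f
        unfolding V_def using that n node by (intro W(3)) auto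
      show ?thesis
        using grid_coupling_bound[OF m n, of "\<omega>" "\<lambda>j. V j n", OF V_bound]
        by (simp add: R_def K_def a_def b_def p_def g_def)
    qed
    have "(\<integral>\<omega>. R n \<omega> \<partial>M) = 2 * (\<Sum>s<n. \<integral>\<omega>. a n s \<omega> \<partial>M) / real n +
        2 * (\<Sum>s<n. \<integral>\<omega>. b n s \<omega> \<partial>M) / real n + (\<Sum>j<m. 2 * (\<integral>\<omega>. V j n \<omega> \<partial>M)) + K n"
      unfolding R_def[abs_def] using int_a int_b int_V a(1)[OF n] b(1)[OF n] EV(1)
      by (simp add: prob_space)
    also have "\<dots> \<le> e n"
    proof -
      have avg: "2 * (\<Sum>s<n. h s) / real n \<le> 2 * c" if "\<And>s. s < n \<Longrightarrow> h s \<le> c" for h c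
      proof -
        have "(\<Sum>s<n. h s) \<le> real n * c"
          using sum_mono[of "{..<n}" h "\<lambda>_. c"] that by simp
        then show ?thesis
          using n by (simp add: pos_divide_le_eq mult_ac)
      qed
      have "2 * (\<Sum>s<n. \<integral>\<omega>. a n s \<omega> \<partial>M) / real n \<le> 2 * (C * (1 / real n))"
        "2 * (\<Sum>s<n. \<integral>\<omega>. b n s \<omega> \<partial>M) / real n \<le> 2 * (C * (1 / real m + 1 / real n))"
        by (intro avg a(2)[OF n] b(2)[OF n]; assumption)+
      then show ?thesis
        by (simp add: e_def EV(2) mult.assoc)
    qed
    finally show "(\<integral>\<omega>. R n \<omega> \<partial>M) \<le> e n" .
  next
    have "e \<longlonglongrightarrow> 2 * C * 0 + 2 * C * (1 / real m + 0) + (\<Sum>j<m. 2 * (\<epsilon> + 0)) +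
        (2 * C * (1 / real m + 0) + 0)"
      unfolding e_def[abs_def] K_def
      by (intro tendsto_intros W(2) node lim_const_over_n lim_1_over_n) auto
    also have "2 * C * 0 + 2 * C * (1 / real m + 0) + (\<Sum>j<m. 2 * (\<epsilon> + 0)) + (2 * C * (1 / real m + 0) + 0) =
        (4 * C + 2) / real m"
      using m0 by (simp add: \<epsilon>_def power2_eq_square field_simps)
    finally show "e \<longlonglongrightarrow> (4 * C + 2) / real m" .
  qed
qed

end

section \<open>Convergence in probability\<close>

theorem corollary3p3:
  fixes M :: "'w measure"
    and X :: "int \<Rightarrow> nat \<Rightarrow> 'w \<Rightarrow> 'a::polish_space"
    and Y :: "int \<Rightarrow> real \<Rightarrow> 'w \<Rightarrow> 'a"
  assumes "prob_space M"
    and "locally_stationary M X Y"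
    and "\<And>u. u \<in> {0..1} \<Longrightarrow> ergodic_process M (\<lambda>t. Y t u)"
  shows "tendsto_in_prob M
    (\<lambda>T \<omega>. SUP u\<in>{0..1}. d_BL (emp_measure X T u \<omega>) (limit_measure M Y u)) 0"
proof -
  interpret prob_space M by fact
  obtain C1 where C1: "\<And>n t. n \<ge> 1 \<Longrightarrow> t \<in> {1..int n} \<Longrightarrow>
      (\<integral>\<omega>. min (dist (X t n \<omega>) (Y t (real_of_int t / real n) \<omega>)) 1 \<partial>M) \<le> C1 * (1 / real n)"
    using assms(2) unfolding locally_stationary_def by blast
  obtain C2 where C2: "\<And>t u v. t \<ge> 1 \<Longrightarrow> u \<in> {0..1} \<Longrightarrow> v \<in> {0..1} \<Longrightarrow>
      (\<integral>\<omega>. min (dist (Y t u \<omega>) (Y t v \<omega>)) 1 \<partial>M) \<le> C2 * \<bar>u - v\<bar>"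
    using assms(2) unfolding locally_stationary_def by blast
  define C where "C = max 0 (max C1 C2)"
  interpret locally_stationary_array M X Y C
  proof
    show "(\<integral>\<omega>. min (dist (X t n \<omega>) (Y t (real_of_int t / real n) \<omega>)) 1 \<partial>M) \<le> C * (1 / real n)"
      if "n \<ge> 1" "t \<in> {1..int n}" for n t
      by (rule order_trans[OF C1[OF that]], rule mult_right_mono) (auto simp: C_def)
    show "(\<integral>\<omega>. min (dist (Y t u \<omega>) (Y t v \<omega>)) 1 \<partial>M) \<le> C * \<bar>u - v\<bar>"
      if "t \<ge> 1" "u \<in> {0..1}" "v \<in> {0..1}" for t u v
      by (rule order_trans[OF C2[OF that]], rule mult_right_mono) (auto simp: C_def)
  qed (use assms in \<open>auto simp: locally_stationary_def C_def\<close>)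
  define S where "S n \<omega> = (SUP u\<in>{0..1}. d_BL (emp_measure X n u \<omega>) (limit_measure M Y u))" for n \<omega>
  have S_meas [measurable]: "S n \<in> borel_measurable M" for n
    unfolding S_def[abs_def] by (rule sup_d_BL_measurable)
  have S_nonneg: "0 \<le> S n \<omega>" for n \<omega>
    using sup_d_BL_upper[of 0 "\<lambda>_. 0" X n \<omega>] BL_norm_zero by (simp add: S_def)
  have "(\<lambda>n. prob {\<omega> \<in> space M. \<bar>S n \<omega> - 0\<bar> > \<epsilon>}) \<longlonglongrightarrow> 0" if \<epsilon>: "\<epsilon> > 0" for \<epsilon>
  proof (rule LIMSEQ_I)
    fix r :: real assume r: "r > 0"
    obtain m :: nat where m': "real m > (4 * C + 2) / (r * \<epsilon>)"
      using reals_Archimedean2 by blast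
    have "(4 * C + 2) / (r * \<epsilon>) > 0"
      using C r \<epsilon> by (simp add: add_nonneg_pos)
    then have m0: "real m > 0" using m' by linarith
    then have m: "m \<ge> 1" by simp
    have small: "(4 * C + 2) / real m < r * \<epsilon>"
      using m' m0 r \<epsilon> by (simp add: divide_less_eq mult.commute)
    obtain R e where R: "\<And>n. n \<ge> 1 \<Longrightarrow> integrable M (R n)"
      "\<And>n \<omega>. n \<ge> 1 \<Longrightarrow> S n \<omega> \<le> R n \<omega>"
      "\<And>n. n \<ge> 1 \<Longrightarrow> (\<integral>\<omega>. R n \<omega> \<partial>M) \<le> e n" "e \<longlonglongrightarrow> (4 * C + 2) / real m"
      unfolding S_def by (rule sup_d_BL_bound_in_mean[OF m]) blast
    have "\<forall>\<^sub>F n in sequentially. e n < r * \<epsilon>"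
      using R(4) small by (rule order_tendstoD)
    then obtain N where N: "\<And>n. n \<ge> N \<Longrightarrow> e n < r * \<epsilon>"
      by (auto simp: eventually_sequentially)
    have "norm (prob {\<omega> \<in> space M. \<bar>S n \<omega> - 0\<bar> > \<epsilon>} - 0) < r" if "n \<ge> max 1 N" for n
    proof -
      have n: "n \<ge> 1" "n \<ge> N" using that by auto
      have [measurable]: "R n \<in> borel_measurable M"
        using R(1)[OF n(1)] by auto
      have "prob {\<omega> \<in> space M. \<bar>S n \<omega> - 0\<bar> > \<epsilon>} \<le> prob {\<omega> \<in> space M. R n \<omega> \<ge> \<epsilon>}"
      proof (rule finite_measure_mono)
        show "{\<omega> \<in> space M. \<bar>S n \<omega> - 0\<bar> > \<epsilon>} \<subseteq> {\<omega> \<in> space M. R n \<omega> \<ge> \<epsilon>}"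
        proof safe
          fix \<omega> assume "\<epsilon> < \<bar>S n \<omega> - 0\<bar>"
          then show "\<epsilon> \<le> R n \<omega>"
            using R(2)[OF n(1), of \<omega>] S_nonneg[of n \<omega>] by linarith
        qed
      qed measurable
      also have "\<dots> \<le> (\<integral>\<omega>. R n \<omega> \<partial>M) / \<epsilon>"
        using R(2)[OF n(1)] S_nonneg \<epsilon>
        by (intro integral_Markov_inequality_measure[where A = "space M"] R(1)[OF n(1)] AE_I2)
          (auto intro: order_trans)
      also have "\<dots> < r"
        using R(3)[OF n(1)] N[OF n(2)] \<epsilon> by (simp add: pos_divide_less_eq)
      finally show ?thesis by simp
    qed
    then show "\<exists>no. \<forall>n\<ge>no. norm (prob {\<omega> \<in> space M. \<bar>S n \<omega> - 0\<bar> > \<epsilon>} - 0) < r" by blast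
  qed
  then show ?thesis
    using S_meas by (simp add: tendsto_in_prob_def S_def[abs_def])
qed

end
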